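(* Let $d\ge1$, suppose $\kappa_d$ is algebraic, and let $D=[\mathbb{Q}(\kappa_d):\mathbb{Q}]$. Assume that $p^k\in E_d$ for a prime $p$ and an integer $k\ge1$, and that $R$ is a real number with $|\alpha|<R$ for every conjugate $\alpha\neq\kappa_d$ of $\kappa_d$ over $\mathbb{Q}$. Then $$p\le\Bigl(\bigl(2^{2d+1}-1\bigr)^{1/(4d)}-1\Bigr)(R+1)^{D-1}.$$
   Context: For integers $d,n\ge1$, $T_d(n)$ is the Cayley graph of $(\mathbb{Z}/n\mathbb{Z})^d$ with respect to $\{\pm e_1,\dots,\pm e_d\}\setminus\{0\}$ ($e_i$ the standard basis vectors); it is a simple graph, and $T_d(1)$ is a single vertex with no edges. $a_d(n)$ is the number of independent sets of $T_d(n)$ (including the empty set). The limit $\kappa_d=\lim_{n\to\infty}a_d(n)^{1/n^d}$ exists and is a positive real number. $E_d=\{n\ge1: a_d(n)=\kappa_d^{n^d}\}$. *)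

(* The type-class libraries are imported last so that irreducible, prime, lead_coeff etc. denote
   their constants and not those of HOL-Algebra. *)
theory Defs
  imports
    "HOL-Algebra.Product_Groups"
    "HOL-Algebra.Elementary_Groups"
    "HOL-Algebra.Generated_Fields"
    "HOL-Algebra.Algebraic_Closure_Type"
    "HOL-Analysis.Analysis"
    "HOL-Computational_Algebra.Polynomial"
    "HOL-Computational_Algebra.Primes"
begin

section \<open>Cayley graphs and independent sets\<close>

text \<open>
  A simple graph is given by its vertex set and a set of two-element sets of vertices.
  Below, \<open>S\<close> is closed under inverses and does not contain the identity, so that
  \<open>cayley_edges G S\<close> is the edge set of a simple graph on \<open>carrier G\<close>.
\<close>

definition cayley_edges :: "('a, 'b) monoid_scheme \<Rightarrow> 'a set \<Rightarrow> 'a set set" where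
  "cayley_edges G S = {{x, x \<otimes>\<^bsub>G\<^esub> s} | x s. x \<in> carrier G \<and> s \<in> S}"

definition independent_sets :: "'a set \<Rightarrow> 'a set set \<Rightarrow> 'a set set" where
  "independent_sets V E = {I. I \<subseteq> V \<and> (\<forall>x\<in>I. \<forall>y\<in>I. {x, y} \<notin> E)}"


section \<open>The discrete torus\<close>

text \<open>The group $(\mathbb{Z}/n\mathbb{Z})^d$; only \<open>n \<ge> 1\<close> is of interest.\<close>

definition torus_group :: "nat \<Rightarrow> nat \<Rightarrow> (nat \<Rightarrow> int) monoid" where
  "torus_group d n = product_group {..<d} (\<lambda>_. integer_mod_group n)"

text \<open>
  The coordinate is \<open>1 mod n\<close> rather than \<open>1\<close> because for \<open>n = 1\<close> the only residue is \<open>0\<close>;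
  then every basis vector is the identity and the generating set is empty.
\<close>

definition torus_basis :: "nat \<Rightarrow> nat \<Rightarrow> nat \<Rightarrow> nat \<Rightarrow> int" where
  "torus_basis d n i = (\<lambda>j\<in>{..<d}. if j = i then 1 mod int n else 0)"

definition torus_gens :: "nat \<Rightarrow> nat \<Rightarrow> (nat \<Rightarrow> int) set" where
  "torus_gens d n =
     (torus_basis d n ` {..<d} \<union> (\<lambda>i. inv\<^bsub>torus_group d n\<^esub> torus_basis d n i) ` {..<d})
       - {\<one>\<^bsub>torus_group d n\<^esub>}"

definition torus_edges :: "nat \<Rightarrow> nat \<Rightarrow> (nat \<Rightarrow> int) set set" where
  "torus_edges d n = cayley_edges (torus_group d n) (torus_gens d n)"

definition num_indep :: "nat \<Rightarrow> nat \<Rightarrow> nat" where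
  "num_indep d n = card (independent_sets (carrier (torus_group d n)) (torus_edges d n))"

definition kappa :: "nat \<Rightarrow> real" where
  "kappa d = lim (\<lambda>n. real (num_indep d n) powr (1 / real (n ^ d)))"

definition exact_sizes :: "nat \<Rightarrow> nat set" where
  "exact_sizes d = {n. n \<ge> 1 \<and> real (num_indep d n) = kappa d ^ (n ^ d)}"


section \<open>Algebraic numbers\<close>

text \<open>$\mathbb{Q}(x)$: the subfield generated by \<open>x\<close> contains the prime field.\<close>

definition rat_adjoin :: "'a::field_char_0 \<Rightarrow> 'a set" where
  "rat_adjoin x = generate_field ring_of_type_algebra {x}"

definition rat_ext_degree :: "'a::field_char_0 \<Rightarrow> nat" where
  "rat_ext_degree x = vector_space.dim (\<lambda>(q::rat) v. of_rat q * v) (rat_adjoin x)"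

text \<open>The minimal polynomial is only meaningful for algebraic \<open>x\<close>.\<close>

definition rat_min_poly :: "'a::field_char_0 \<Rightarrow> rat poly" where
  "rat_min_poly x =
     (THE p. lead_coeff p = 1 \<and> irreducible p \<and> poly (map_poly of_rat p) x = 0)"

definition rat_conjugates :: "'a::field_char_0 \<Rightarrow> complex set" where
  "rat_conjugates x = {\<alpha>. poly (map_poly of_rat (rat_min_poly x)) \<alpha> = 0}"

end

theory Submission
  imports Defs "HOL-Number_Theory.Cong"
begin

text \<open>
  Let $n = p^k \in E_d$ and write $\kappa = \kappa_d$, so $\kappa^{n^d} = a_d(n)$. Translation by
  $e_1$ generates a cyclic group of order $n$ that acts on the independent sets of $T_d(n)$ and
  fixes only the empty set, hence $a_d(n) \equiv 1 \pmod p$ and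
  $(\kappa - 1)^{n^d} \equiv \kappa^{n^d} - 1 \equiv 0$ modulo $p$. For the minimal polynomial $m$
  of $\kappa$, which is integral, this forces $p \mid m(1) \neq 0$. Therefore
  $p \le |m(1)| = (\kappa - 1) \prod_{\alpha \neq \kappa} |1 - \alpha|
  \le (\kappa - 1) (R + 1)^{D-1}$.
  Finally $\kappa^{4d} \le 2^{2d+1} - 1$ is the Kahn--Zhao bound for the bipartite $2d$-regular
  graphs $T_d(n)$ with $n \ge 4$ even, which follows from Finner's generalised Hoelder inequality;
  here one needs that the limit $\kappa$ exists, which comes from comparing $T_d(n)$ with a box
  in $\mathbb{Z}^d$ and subadditivity.
\<close>

section \<open>Independent sets in regular bipartite graphs\<close>

text \<open>For odd \<open>n\<close> of at least 3 the torus is not bipartite, and for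
  \<open>n = 2\<close> the vectors e_i and -e_i coincide; so the Kahn--Zhao bound with degree 2d is
  available only along a subsequence, and it says something about \<kappa> only because the whole
  sequence converges. Tori are not visibly subadditive, since cutting one destroys its wrap-around
  edges, whereas boxes split into boxes; this is why the limit is found on boxes first. On the
  arithmetic side the congruence for \<kappa> - 1 is a statement about norms, but no ring of
  integers is set up: its place is taken by a factorisation of x^N - a over the integers, with N =
  n^d again a power of \<open>p\<close>. The value m(1) has to be nonzero before \<open>p\<close>
  can bound it, and this is where a_d(n) being at least 2 enters.\<close>

lemma finite_independent_sets: "finite V \<Longrightarrow> finite (independent_sets V E)"
  by (rule finite_subset[of _ "Pow V"]) (auto simp: independent_sets_def)

text \<open>Hoelder's inequality on a two-point space, with as many factors as the exponent. Once
  each pair (\<open>u i\<close>, \<open>v i\<close>) is scaled to norm 1, it is the sum of the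
  arithmetic-geometric mean inequalities for \<open>u\<close> and for \<open>v\<close>.\<close>

lemma sum_prod_le_prod_root:
  fixes u v :: "'i \<Rightarrow> real"
  assumes I: "finite I" "I \<noteq> {}" and u: "\<And>i. i \<in> I \<Longrightarrow> u i \<ge> 0" and v: "\<And>i. i \<in> I \<Longrightarrow> v i \<ge> 0"
  shows "(\<Prod>i\<in>I. u i) + (\<Prod>i\<in>I. v i) \<le> (\<Prod>i\<in>I. root (card I) (u i ^ card I + v i ^ card I))"
    (is "_ \<le> (\<Prod>i\<in>I. ?r i)")
\<comment> \<open>A pair of zeros cannot be scaled, but it makes both products on the left
  vanish.\<close>
proof (cases "\<exists>i\<in>I. u i = 0 \<and> v i = 0")
  case True
  then have "(\<Prod>i\<in>I. u i) = 0" "(\<Prod>i\<in>I. v i) = 0"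
    using I(1) by (auto intro: prod_zero)
  moreover have "(\<Prod>i\<in>I. ?r i) \<ge> 0"
    using u v by (intro prod_nonneg ballI real_root_ge_zero add_nonneg_nonneg zero_le_power)
  ultimately show ?thesis by simp
next
  case False
  define n where "n = card I"
  have n: "n > 0" using I by (simp add: n_def card_gt_0_iff)
  have r: "?r i > 0" if "i \<in> I" for i
  proof -
    have "u i ^ n + v i ^ n > 0"
      using False that u[OF that] v[OF that] n
      by (metis add_nonneg_pos add_pos_nonneg order_le_less zero_less_power zero_le_power)
    then show ?thesis using n by (simp add: n_def)
  qed
  have amgm: "(\<Prod>i\<in>I. x i) \<le> (\<Sum>i\<in>I. x i ^ n) / n"
    if "\<And>i. i \<in> I \<Longrightarrow> x i \<ge> 0" for x :: "'i \<Rightarrow> real"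
  proof -
    have nn: "(\<Prod>i\<in>I. x i) \<ge> 0" using that by (rule prod_nonneg)
    have "(\<Prod>i\<in>I. x i) = ((\<Prod>i\<in>I. x i) ^ n) powr (1 / n)"
      using nn n by (cases "(\<Prod>i\<in>I. x i) = 0") (simp_all add: powr_powr flip: powr_realpow)
    also have "\<dots> = (\<Prod>i\<in>I. x i ^ n) powr (1 / n)"
      by (simp add: prod_power_distrib)
    also have "\<dots> \<le> (\<Sum>i\<in>I. x i ^ n / n)"
      using arith_geom_mean[of I "\<lambda>i. x i ^ n"] I that by (simp add: n_def)
    finally show ?thesis by (simp add: sum_divide_distrib)
  qed
  have "(\<Prod>i\<in>I. u i / ?r i) + (\<Prod>i\<in>I. v i / ?r i)
      \<le> (\<Sum>i\<in>I. (u i / ?r i) ^ n) / n + (\<Sum>i\<in>I. (v i / ?r i) ^ n) / n"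
    using r u v by (intro add_mono amgm divide_nonneg_pos)
  also have "\<dots> = (\<Sum>i\<in>I. (u i / ?r i) ^ n + (v i / ?r i) ^ n) / n"
    by (simp add: sum.distrib add_divide_distrib)
  also have "\<dots> = (\<Sum>i\<in>I. 1) / n"
  proof -
    have "(u i / ?r i) ^ n + (v i / ?r i) ^ n = 1" if "i \<in> I" for i
    proof -
      have "?r i ^ n = u i ^ n + v i ^ n"
        unfolding n_def[symmetric] using n u[OF that] v[OF that] by (intro real_root_pow_pos2) auto
      moreover have "?r i ^ n > 0" using r[OF that] by simp
      ultimately show ?thesis by (simp add: power_divide add_divide_distrib[symmetric])
    qed
    then show ?thesis by simp
  qed
  also have "\<dots> = 1" using n by (simp add: n_def)
  finally have "((\<Prod>i\<in>I. u i) + (\<Prod>i\<in>I. v i)) / (\<Prod>i\<in>I. ?r i) \<le> 1"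
    by (simp add: prod_dividef add_divide_distrib)
  moreover have "(\<Prod>i\<in>I. ?r i) > 0" using r by (intro prod_pos) auto
  ultimately show ?thesis by (simp add: divide_le_eq)
qed

lemma sum_Pow_insert:
  assumes "finite A" "a \<notin> A"
  shows "(\<Sum>W\<in>Pow (insert a A). f W) = (\<Sum>W\<in>Pow A. f W + f (insert a W))"
proof -
  have "inj_on (insert a) (Pow A)" using assms(2) by (auto simp: inj_on_def)
  moreover have "Pow A \<inter> insert a ` Pow A = {}" using assms(2) by auto
  ultimately show ?thesis using assms(1)
    by (simp add: Pow_insert sum.union_disjoint sum.reindex sum.distrib)
qed

text \<open>
  Finner's inequality, with the subsets of \<open>A\<close> standing for the points of \<open>{0,1}\<^sup>A\<close>. Summing over
  one coordinate by Hoelder replaces each factor that involves it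
    by its \<open>n\<close>-norm in that coordinate.
\<close>

lemma finner_Pow:
  fixes f :: "'b \<Rightarrow> 'a set \<Rightarrow> real"
  assumes "finite A" "finite B" "n > 0"
    and "\<And>a. a \<in> A \<Longrightarrow> card {b \<in> B. a \<in> N b} = n"
    and "\<And>b Y. b \<in> B \<Longrightarrow> f b Y \<ge> 0"
  shows "(\<Sum>W\<in>Pow A. \<Prod>b\<in>B. f b (W \<inter> N b)) \<le> (\<Prod>b\<in>B. root n (\<Sum>Y\<in>Pow (A \<inter> N b). f b Y ^ n))"
  using assms(1,4,5)
proof (induction A arbitrary: f rule: finite_induct)
  case empty
  then show ?case using \<open>n > 0\<close> by (simp add: real_root_power_cancel)
next
  case (insert a A)
  define f' where "f' b Y = (if a \<in> N b then root n (f b Y ^ n + f b (insert a Y) ^ n) else f b Y)" for b Y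
  have f'0: "f' b Y \<ge> 0" if "b \<in> B" for b Y using insert.prems(2) that \<open>n > 0\<close>
    by (auto simp: f'_def)
  have step: "(\<Prod>b\<in>B. f b (W \<inter> N b)) + (\<Prod>b\<in>B. f b (insert a W \<inter> N b)) \<le> (\<Prod>b\<in>B. f' b (W \<inter> N b))"
    if "W \<in> Pow A" for W
  proof -
    \<comment> \<open>By regularity exactly \<open>n\<close> factors see the point \<open>a\<close>,
      which matches the exponent; the factors over \<open>?J\<close> do not depend on
      \<open>a\<close> and come out of the sum.\<close>
    let ?I = "{b \<in> B. a \<in> N b}" and ?J = "{b \<in> B. a \<notin> N b}"
    have cI: "card ?I = n" using insert.prems(1) by simp
    have split: "(\<Prod>b\<in>B. g b) = (\<Prod>b\<in>?I. g b) * (\<Prod>b\<in>?J. g b)" for g :: "'b \<Rightarrow> real"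
    proof -
      have "B = ?I \<union> ?J" by auto
      then show ?thesis using \<open>finite B\<close>
        by (metis (no_types, lifting) prod.union_disjoint disjoint_iff mem_Collect_eq finite_Un)
    qed
    let ?u = "\<lambda>b. f b (W \<inter> N b)" and ?v = "\<lambda>b. f b (insert a W \<inter> N b)"
    have "?I \<noteq> {}" using cI \<open>n > 0\<close> by (metis card.empty less_irrefl)
    then have H: "(\<Prod>b\<in>?I. ?u b) + (\<Prod>b\<in>?I. ?v b) \<le> (\<Prod>b\<in>?I. root n (?u b ^ n + ?v b ^ n))"
      using sum_prod_le_prod_root[of ?I ?u ?v] insert.prems(2) \<open>finite B\<close> cI by simp
    have J: "(\<Prod>b\<in>?J. ?v b) = (\<Prod>b\<in>?J. ?u b)" by (intro prod.cong) auto
    have "(\<Prod>b\<in>B. ?u b) + (\<Prod>b\<in>B. ?v b) = ((\<Prod>b\<in>?I. ?u b) + (\<Prod>b\<in>?I. ?v b)) * (\<Prod>b\<in>?J. ?u b)"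
      by (simp only: split[of ?u] split[of ?v] J) (simp add: algebra_simps)
    also have "\<dots> \<le> (\<Prod>b\<in>?I. root n (?u b ^ n + ?v b ^ n)) * (\<Prod>b\<in>?J. ?u b)"
      using H insert.prems(2) by (intro mult_right_mono prod_nonneg) auto
    also have "\<dots> = (\<Prod>b\<in>B. f' b (W \<inter> N b))"
      by (subst split, intro arg_cong2[of _ _ _ _ "(*)"] prod.cong) (auto simp: f'_def Int_insert_left)
    finally show ?thesis .
  qed
  have sums: "(\<Sum>Y\<in>Pow (A \<inter> N b). f' b Y ^ n) = (\<Sum>Y\<in>Pow (insert a A \<inter> N b). f b Y ^ n)" if b: "b \<in> B" for b
  proof (cases "a \<in> N b")
    case True
    then have "insert a A \<inter> N b = insert a (A \<inter> N b)" by auto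
    moreover have "f' b Y ^ n = f b Y ^ n + f b (insert a Y) ^ n" for Y
      using True \<open>n > 0\<close> insert.prems(2)[OF b] by (simp add: f'_def real_root_pow_pos2)
    ultimately show ?thesis using insert.hyps by (simp add: sum_Pow_insert)
  next
    case False
    then show ?thesis by (simp add: f'_def Int_insert_left)
  qed
  have "(\<Sum>W\<in>Pow (insert a A). \<Prod>b\<in>B. f b (W \<inter> N b))
      = (\<Sum>W\<in>Pow A. (\<Prod>b\<in>B. f b (W \<inter> N b)) + (\<Prod>b\<in>B. f b (insert a W \<inter> N b)))"
    using insert.hyps by (rule sum_Pow_insert)
  also have "\<dots> \<le> (\<Sum>W\<in>Pow A. \<Prod>b\<in>B. f' b (W \<inter> N b))"
    by (intro sum_mono step)
  also have "\<dots> \<le> (\<Prod>b\<in>B. root n (\<Sum>Y\<in>Pow (A \<inter> N b). f' b Y ^ n))"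
    using insert.prems(1) f'0 by (intro insert.IH) auto
  also have "\<dots> = (\<Prod>b\<in>B. root n (\<Sum>Y\<in>Pow (insert a A \<inter> N b). f b Y ^ n))"
    using sums by (intro prod.cong) auto
  finally show ?case .
qed

text \<open>Once the part \<open>W\<close> inside \<open>A\<close> is fixed, a vertex
  \<open>b\<close> has two options if \<open>W\<close> misses its neighbourhood, and otherwise it
  must stay out. The count is thus at most a sum over \<open>W\<close> of products of local factors,
  the shape that \<open>finner_Pow\<close> bounds.\<close>

lemma card_independent_sets_bipartite:
  assumes A: "finite A" and B: "finite B" and n: "n > 0"
    and NA: "\<And>b. b \<in> B \<Longrightarrow> N b \<subseteq> A" and Nn: "\<And>b. b \<in> B \<Longrightarrow> card (N b) = n"
    and reg: "\<And>a. a \<in> A \<Longrightarrow> card {b \<in> B. a \<in> N b} = n"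
    and E: "\<And>a b. b \<in> B \<Longrightarrow> a \<in> N b \<Longrightarrow> {a, b} \<in> E"
  shows "real (card (independent_sets (A \<union> B) E)) \<le> (2 ^ (n + 1) - 1) powr (real (card B) / real n)"
proof -
  define g where "g W = Pow {b \<in> B. W \<inter> N b = {}}" for W
  define f :: "'a \<Rightarrow> 'a set \<Rightarrow> real" where "f b Y = (if Y = {} then 2 else 1)" for b Y
  have cg: "real (card (g W)) = (\<Prod>b\<in>B. f b (W \<inter> N b))" for W
  proof -
    have "(\<Prod>b\<in>B. f b (W \<inter> N b)) = (\<Prod>b\<in>B \<inter> {b. W \<inter> N b = {}}. 2) * (\<Prod>b\<in>B \<inter> - {b. W \<inter> N b = {}}. 1)"
      unfolding f_def by (rule prod.If_cases[OF B])
    also have "\<dots> = 2 ^ card (B \<inter> {b. W \<inter> N b = {}})" by simp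
    also have "B \<inter> {b. W \<inter> N b = {}} = {b \<in> B. W \<inter> N b = {}}" by auto
    finally show ?thesis using B by (simp add: g_def card_Pow)
  qed
  have "inj_on (\<lambda>I. (I \<inter> A, I \<inter> B)) (independent_sets (A \<union> B) E)"
    by (auto simp: inj_on_def independent_sets_def)
  moreover have "(\<lambda>I. (I \<inter> A, I \<inter> B)) ` independent_sets (A \<union> B) E \<subseteq> Sigma (Pow A) g"
  proof (rule image_subsetI)
    fix I assume I: "I \<in> independent_sets (A \<union> B) E"
    have "I \<inter> A \<inter> N b = {}" if b: "b \<in> I" "b \<in> B" for b
      using I b E[OF b(2)] by (auto simp: independent_sets_def)
    then show "(I \<inter> A, I \<inter> B) \<in> Sigma (Pow A) g"
      by (auto simp: g_def)
  qed
  moreover have "finite (Sigma (Pow A) g)"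
    using A B by (intro finite_SigmaI) (simp_all add: g_def)
  ultimately have "card (independent_sets (A \<union> B) E) \<le> card (Sigma (Pow A) g)"
    by (rule card_inj_on_le)
  also have "card (Sigma (Pow A) g) = (\<Sum>W\<in>Pow A. card (g W))"
    using A B by (intro card_SigmaI) (simp_all add: g_def)
  finally have "real (card (independent_sets (A \<union> B) E)) \<le> real (\<Sum>W\<in>Pow A. card (g W))"
    by (rule of_nat_mono)
  also have "\<dots> = (\<Sum>W\<in>Pow A. \<Prod>b\<in>B. f b (W \<inter> N b))"
    by (simp only: of_nat_sum cg)
  also have "\<dots> \<le> (\<Prod>b\<in>B. root n (\<Sum>Y\<in>Pow (A \<inter> N b). f b Y ^ n))"
    using A B n reg by (intro finner_Pow) (auto simp: f_def)
  also have "\<dots> = (\<Prod>b\<in>B. root n (2 ^ (n + 1) - 1))"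
  proof (intro prod.cong refl arg_cong[of _ _ "root n"])
    fix b assume b: "b \<in> B"
    then have "A \<inter> N b = N b" "finite (N b)" using NA A by (auto intro: finite_subset)
    then have "(\<Sum>Y\<in>Pow (A \<inter> N b). f b Y ^ n) = (\<Sum>Y\<in>insert {} (Pow (N b) - {{}}). f b Y ^ n)"
      by (intro sum.cong) auto
    \<comment> \<open>The empty trace contributes \<open>2 ^ n\<close>, each of the other
      \<open>2 ^ n - 1\<close> traces contributes 1.\<close>
    also have "\<dots> = 2 ^ n + (\<Sum>Y\<in>Pow (N b) - {{}}. 1)"
      using \<open>finite (N b)\<close> by (subst sum.insert) (auto simp: f_def intro!: sum.cong)
    also have "\<dots> = 2 ^ n + (2 ^ n - 1)"
      using \<open>finite (N b)\<close> Nn[OF b]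
      by (simp add: card_Diff_singleton card_Pow of_nat_diff)
    finally show "(\<Sum>Y\<in>Pow (A \<inter> N b). f b Y ^ n) = 2 ^ (n + 1) - 1" by simp
  qed
  also have "\<dots> = (2 ^ (n + 1) - 1) powr (real (card B) / real n)"
  proof -
    define c :: real where "c = 2 ^ (n + 1) - 1"
    have "c > 0" using one_less_power[of "2::real" "n + 1"] by (simp add: c_def)
    then show ?thesis
      using n unfolding c_def[symmetric]
      by (simp add: root_powr_inverse powr_powr flip: powr_realpow)
  qed
  finally show ?thesis .
qed

section \<open>Independent sets in Cayley graphs\<close>

text \<open>On \<open>S\<close> the powers of \<open>g\<close> form a cyclic group whose order
  divides \<open>p ^ k\<close>, so orbit sizes divide \<open>p ^ k\<close>, and an orbit with more
  than one point has size divisible by \<open>p\<close>.\<close>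

lemma card_cong_card_fixpoints:
  assumes S: "finite S" "g ` S \<subseteq> S" and p: "prime p"
    and per: "\<And>x. x \<in> S \<Longrightarrow> (g ^^ (p ^ k)) x = x"
  shows "[card S = card {x \<in> S. g x = x}] (mod p)"
proof -
  define orb where "orb x = range (\<lambda>i. (g ^^ i) x)" for x
  have self: "x \<in> orb x" for x unfolding orb_def by (rule range_eqI[of _ _ 0]) simp
  have inS: "(g ^^ i) x \<in> S" if "x \<in> S" for i x
    using S(2) that by (induction i) auto
  have per': "(g ^^ (j * p ^ k)) x = x" if "x \<in> S" for j x
    using that per by (induction j) (simp_all add: funpow_add)
  have sub: "orb y \<subseteq> orb x" if "y \<in> orb x" for x y
  proof -
    obtain i where "y = (g ^^ i) x" using \<open>y \<in> orb x\<close> by (auto simp: orb_def)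
    then have "(g ^^ j) y = (g ^^ (j + i)) x" for j by (simp add: funpow_add)
    then show ?thesis by (auto simp: orb_def)
  qed
  have sym: "x \<in> orb y" if "x \<in> S" "y \<in> orb x" for x y
  proof -
    obtain i where i: "y = (g ^^ i) x" using \<open>y \<in> orb x\<close> by (auto simp: orb_def)
    \<comment> \<open>\<open>i * p ^ k\<close> is a multiple of the period and not below
      \<open>i\<close>, so forward iteration alone leads from \<open>y\<close> back to
      \<open>x\<close>.\<close>
    have "p ^ k > 0" using p by (simp add: prime_gt_0_nat)
    then have "i \<le> i * p ^ k" by (cases "p ^ k") auto
    then have "(g ^^ (i * p ^ k - i)) y = (g ^^ (i * p ^ k)) x"
      unfolding i by (simp flip: funpow_add comp_apply[of "g ^^ _" "g ^^ _"])
    then show ?thesis using per'[OF that(1)] by (auto simp: orb_def)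
  qed
  have eq: "orb y = orb x" if "x \<in> S" "y \<in> orb x" for x y
    using sub[OF that(2)] sub[OF sym[OF that]] by blast
  have dvd: "card (orb x) dvd p ^ k" if x: "x \<in> S" for x
  proof -
    define t where "t = (LEAST t. t > 0 \<and> (g ^^ t) x = x)"
    have ex: "p ^ k > 0 \<and> (g ^^ (p ^ k)) x = x" using p per[OF x] by (simp add: prime_gt_0_nat)
    have t: "t > 0" "(g ^^ t) x = x"
      using LeastI[of "\<lambda>t. t > 0 \<and> (g ^^ t) x = x", OF ex] by (auto simp: t_def)
    have least: "t \<le> i" if "i > 0" "(g ^^ i) x = x" for i
      unfolding t_def using that by (intro Least_le) auto
    have tmod: "(g ^^ i) x = (g ^^ (i mod t)) x" for i
      using funpow_mod_eq[OF t(2)] by simp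
    have "orb x = (\<lambda>i. (g ^^ i) x) ` {..<t}"
    proof (intro equalityI subsetI)
      fix y assume "y \<in> orb x"
      then obtain i where "y = (g ^^ i) x" by (auto simp: orb_def)
      then show "y \<in> (\<lambda>i. (g ^^ i) x) ` {..<t}" using tmod[of i] t(1) by auto
    qed (auto simp: orb_def)
    moreover have "inj_on (\<lambda>i. (g ^^ i) x) {..<t}"
    proof (rule linorder_inj_onI')
      fix i j assume ij: "i \<in> {..<t}" "j \<in> {..<t}" "i < j"
      show "(g ^^ i) x \<noteq> (g ^^ j) x"
      proof
        assume e: "(g ^^ i) x = (g ^^ j) x"
        \<comment> \<open>A repetition among the first \<open>t\<close> iterates would produce the
          smaller period \<open>t - j + i\<close>.\<close>
        have "(g ^^ (t - j + i)) x = (g ^^ (t - j)) ((g ^^ j) x)"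
          by (simp add: funpow_add e)
        also have "\<dots> = x" using ij t(2)
          by (simp flip: funpow_add comp_apply[of "g ^^ _" "g ^^ _"])
        finally show False using least[of "t - j + i"] ij by simp
      qed
    qed
    ultimately have c: "card (orb x) = t" by (simp add: card_image)
    have "(g ^^ (p ^ k mod t)) x = x" using tmod[of "p ^ k"] per[OF x] by simp
    then have "p ^ k mod t = 0" using least[of "p ^ k mod t"] mod_less_divisor[OF t(1), of "p ^ k"]
      by (cases "p ^ k mod t = 0") auto
    then show ?thesis unfolding c by auto
  qed
  let ?M = "{x \<in> S. g x \<noteq> x}"
  have orbM: "orb x \<subseteq> ?M" if "x \<in> ?M" for x
  proof
    fix y assume y: "y \<in> orb x"
    then have "y \<in> S" using that inS by (auto simp: orb_def)
    moreover have "g y \<noteq> y"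
    proof
      assume "g y = y"
      then have "(g ^^ i) y = y" for i by (induction i) auto
      then have "orb y = {y}" by (auto simp: orb_def)
      then have "x = y" using sym[of x y] that y by auto
      with \<open>g y = y\<close> that show False by auto
    qed
    ultimately show "y \<in> ?M" by simp
  qed
  then have M: "?M = \<Union> (orb ` ?M)" using self by blast
  have "p dvd card (\<Union> (orb ` ?M))"
  proof (rule dvd_partition)
    show "finite (\<Union> (orb ` ?M))" using M S(1)
      by (metis (no_types, lifting) finite_subset mem_Collect_eq subsetI)
    show "\<forall>c\<in>orb ` ?M. p dvd card c"
    proof clarify
      fix x assume x: "x \<in> S" "g x \<noteq> x"
      have fin: "finite (orb x)" using orbM[of x] x S(1) by (auto intro: finite_subset)
      have "g x \<in> orb x" unfolding orb_def by (rule range_eqI[of _ _ 1]) simp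
      then have "card (orb x) \<noteq> 1" using self[of x] x(2) by (auto simp: card_1_singleton_iff)
      moreover obtain i where "card (orb x) = p ^ i"
        using dvd[OF x(1)] p divides_primepow_nat by blast
      ultimately show "p dvd card (orb x)" by (cases i) auto
    qed
    show "\<forall>c1\<in>orb ` ?M. \<forall>c2\<in>orb ` ?M. c1 \<noteq> c2 \<longrightarrow> c1 \<inter> c2 = {}"
    proof clarify
      fix x y assume "x \<in> S" "y \<in> S" "orb x \<noteq> orb y"
      then show "orb x \<inter> orb y = {}" using eq by (metis disjoint_iff)
    qed
  qed
  moreover have "card S = card {x \<in> S. g x = x} + card ?M"
    using S(1) by (subst card_Un_disjoint[symmetric]) (auto intro: arg_cong[of _ _ card])
  ultimately show ?thesis using M by (auto simp: cong_def mod_add_right_eq elim!: dvdE)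
qed

text \<open>Left translation respects edges, as these come from right multiplication. A nonempty set
  invariant under \<open>s\<close> contains some x together with s x, and commutativity turns s x
  into the neighbour x s; so only the empty set is fixed.\<close>

lemma (in comm_group) card_independent_sets_cayley_cong_1:
  assumes fin: "finite (carrier G)" and S: "S \<subseteq> carrier G" and s: "s \<in> S" "s [^] (p ^ k) = \<one>"
    and p: "prime p"
  shows "[card (independent_sets (carrier G) (cayley_edges G S)) = 1] (mod p)"
proof -
  let ?I = "independent_sets (carrier G) (cayley_edges G S)"
  define T where "T = (`) ((\<otimes>) s)"
  have sc: "s \<in> carrier G" using S s by auto
  have iter: "(T ^^ i) I = (\<otimes>) (s [^] i) ` I" if "I \<subseteq> carrier G" for i I
  proof (induction i)
    case 0
    then show ?case using that by (force simp: image_iff)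
  next
    case (Suc i)
    have "(T ^^ Suc i) I = T ((T ^^ i) I)" by simp
    also have "\<dots> = (\<lambda>x. s \<otimes> (s [^] i \<otimes> x)) ` I"
      unfolding Suc by (simp add: T_def image_image)
    also have "\<dots> = (\<lambda>x. s [^] Suc i \<otimes> x) ` I"
      using that sc unfolding nat_pow_Suc2[OF sc] by (intro image_cong refl) (auto simp: m_assoc)
    finally show ?case .
  qed
  have "[card ?I = card {I \<in> ?I. T I = I}] (mod p)"
  proof (rule card_cong_card_fixpoints)
    show "finite ?I"
      by (rule finite_independent_sets[OF fin])
    show "T ` ?I \<subseteq> ?I"
    proof (rule image_subsetI)
      fix I assume I: "I \<in> ?I"
      have "{s \<otimes> x, s \<otimes> y} \<notin> cayley_edges G S"
        if "x \<in> I" "y \<in> I" for x y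
      proof
        assume "{s \<otimes> x, s \<otimes> y} \<in> cayley_edges G S"
        then obtain z u where zu: "{s \<otimes> x, s \<otimes> y} = {z, z \<otimes> u}" "z \<in> carrier G" "u \<in> S"
          by (auto simp: cayley_edges_def)
        have xy: "x \<in> carrier G" "y \<in> carrier G" using I that
          by (auto simp: independent_sets_def)
        define w where "w = inv s \<otimes> z"
        have w: "w \<in> carrier G" "z = s \<otimes> w" using zu sc
          by (auto simp: w_def m_assoc[symmetric])
        have u: "u \<in> carrier G" using zu S by auto
        have "{x, y} = {w, w \<otimes> u}"
          using zu(1) xy w u sc by (auto simp: doubleton_eq_iff m_assoc)
        then have "{x, y} \<in> cayley_edges G S" using w zu by (auto simp: cayley_edges_def)
        with I that show False by (auto simp: independent_sets_def)
      qed
      then show "T I \<in> ?I" using I sc by (auto simp: independent_sets_def T_def)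
    qed
    show "(T ^^ (p ^ k)) I = I" if "I \<in> ?I" for I
    proof -
      have "I \<subseteq> carrier G" using that by (auto simp: independent_sets_def)
      then show ?thesis unfolding iter[OF \<open>I \<subseteq> carrier G\<close>] s(2)
        by (force simp: image_iff)
    qed
  qed fact
  moreover have "{I \<in> ?I. T I = I} = {{}}"
  proof (intro equalityI subsetI)
    fix I assume I: "I \<in> {I \<in> ?I. T I = I}"
    have False if "x \<in> I" for x
    proof -
      have x: "x \<in> carrier G" using I that by (auto simp: independent_sets_def)
      have "s \<otimes> x \<in> I" using I that by (auto simp: T_def)
      moreover have "s \<otimes> x = x \<otimes> s" by (rule m_comm[OF sc x])
      ultimately have "{x, x \<otimes> s} \<notin> cayley_edges G S" using I that
        by (auto simp: independent_sets_def)
      then show False using x s by (auto simp: cayley_edges_def)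
    qed
    then show "I \<in> {{}}" by blast
  qed (auto simp: independent_sets_def T_def)
  ultimately show ?thesis by simp
qed

text \<open>\<open>par\<close> is a proper 2-colouring. Right multiplication by an element of
  \<open>S\<close> swaps the colour classes, so each has half of the vertices; closure under
  inverses makes adjacency symmetric and gives degree \<open>card S\<close> on both sides.\<close>

lemma (in group) card_independent_sets_cayley_bipartite:
  assumes fin: "finite (carrier G)" and S: "S \<subseteq> carrier G" "S \<noteq> {}"
    and inv: "\<And>s. s \<in> S \<Longrightarrow> inv s \<in> S"
    and chi: "\<And>x s. x \<in> carrier G \<Longrightarrow> s \<in> S \<Longrightarrow> par (x \<otimes> s) \<longleftrightarrow> \<not> par x"
  shows "real (card (independent_sets (carrier G) (cayley_edges G S)))
    \<le> (2 ^ (card S + 1) - 1) powr (real (card (carrier G)) / (2 * real (card S)))"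
proof -
  define A where "A = {x \<in> carrier G. par x}"
  define B where "B = {x \<in> carrier G. \<not> par x}"
  define N where "N b = (\<otimes>) b ` S" for b
  have finAB: "finite A" "finite B" using fin by (auto simp: A_def B_def)
  have finS: "finite S" using S fin finite_subset by blast
  have cN: "card (N b) = card S" if "b \<in> carrier G" for b
    unfolding N_def using that S by (intro card_image) (auto simp: inj_on_def subset_iff)
  have N_sym: "a \<in> N b \<longleftrightarrow> b \<in> N a"
    if "a \<in> carrier G" "b \<in> carrier G" for a b
  proof -
    have *: "b \<in> N a" if "a \<in> N b" "b \<in> carrier G" for a b
    proof -
      obtain s where s: "s \<in> S" "a = b \<otimes> s" using \<open>a \<in> N b\<close>
        unfolding N_def by blast
      then have "b = a \<otimes> inv s" using S that by (auto simp: m_assoc subset_iff)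
      then show ?thesis using inv[OF s(1)] by (auto simp: N_def)
    qed
    show ?thesis using * that by blast
  qed
  have NA: "N b \<subseteq> A" if "b \<in> B" for b using that S chi
    by (auto simp: N_def A_def B_def)
  have NB: "N a \<subseteq> B" if "a \<in> A" for a using that S chi
    by (auto simp: N_def A_def B_def)
  obtain s where s: "s \<in> S" using S by auto
  have "card A = card B"
  proof (rule card_bij_eq)
    show "inj_on (\<lambda>x. x \<otimes> s) A" "inj_on (\<lambda>x. x \<otimes> s) B"
      using s S by (auto simp: inj_on_def A_def B_def subset_iff)
    show "(\<lambda>x. x \<otimes> s) ` A \<subseteq> B" "(\<lambda>x. x \<otimes> s) ` B \<subseteq> A"
      using s S chi by (auto simp: A_def B_def subset_iff)
  qed (use finAB in auto)
  moreover have "card (carrier G) = card A + card B"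
    using finAB by (subst card_Un_disjoint[symmetric]) (auto simp: A_def B_def intro!: arg_cong[of _ _ card])
  ultimately have cB: "real (card B) = real (card (carrier G)) / 2" by simp
  have "real (card (independent_sets (A \<union> B) (cayley_edges G S)))
      \<le> (2 ^ (card S + 1) - 1) powr (real (card B) / real (card S))"
  proof (rule card_independent_sets_bipartite)
    show "card S > 0" using finS S by (simp add: card_gt_0_iff)
    show "card {b \<in> B. a \<in> N b} = card S" if "a \<in> A" for a
    proof -
      have "{b \<in> B. a \<in> N b} = N a" using that NB[OF that] N_sym[of a]
        by (auto simp: A_def B_def)
      then show ?thesis using cN[of a] that by (simp add: A_def)
    qed
    show "{a, b} \<in> cayley_edges G S" if "b \<in> B" "a \<in> N b" for a b
      using that unfolding cayley_edges_def N_def B_def by (auto simp: insert_commute)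
  qed (use finAB NA cN in \<open>auto simp: B_def\<close>)
  moreover have "A \<union> B = carrier G" by (auto simp: A_def B_def)
  ultimately show ?thesis unfolding cB by simp
qed

section \<open>Minimal polynomials over the rationals\<close>

lemma map_poly_add_hom:
  assumes "f 0 = 0" "\<And>a b. f (a + b) = f a + f b"
  shows "map_poly f (p + q) = map_poly f p + map_poly f q"
  by (rule poly_eqI) (simp add: coeff_map_poly assms)

lemma map_poly_mult_hom:
  assumes "f 0 = 0" "\<And>a b. f (a + b) = f a + f b" "\<And>a b. f (a * b) = f a * f b"
  shows "map_poly f (p * q) = map_poly f p * map_poly f q"
proof (rule poly_eqI)
  fix n
  have "f (sum g A) = (\<Sum>x\<in>A. f (g x))" if "finite A" for g :: "nat \<Rightarrow> _" and A
    using that by induction (simp_all add: assms)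
  then show "coeff (map_poly f (p * q)) n = coeff (map_poly f p * map_poly f q) n"
    by (simp add: coeff_map_poly coeff_mult assms)
qed

abbreviation rat_poly :: "rat poly \<Rightarrow> 'a::field_char_0 poly" where
  "rat_poly \<equiv> map_poly of_rat"

lemma rat_poly_add: "rat_poly (p + q) = rat_poly p + rat_poly q"
  by (intro map_poly_add_hom) (simp_all add: of_rat_add)

lemma rat_poly_mult: "rat_poly (p * q) = rat_poly p * rat_poly q"
  by (intro map_poly_mult_hom) (simp_all add: of_rat_add of_rat_mult)

lemma int_poly_mult: "map_poly of_int (p * q) = (map_poly of_int p * map_poly of_int q :: 'a::comm_ring_1 poly)"
  by (intro map_poly_mult_hom) simp_all

lemma bezout_irreducible:
  fixes m q :: "rat poly"
  assumes "irreducible m" "\<not> m dvd q"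
  obtains u v where "u * m + v * q = 1"
proof -
  have "prime_elem m" using assms(1) by (rule field_poly_irreducible_imp_prime)
  then have "coprime m q" using assms(2) by (simp add: prime_elem_imp_coprime)
  then have "fst (bezout_coefficients m q) * m + snd (bezout_coefficients m q) * q = 1"
    by (simp add: bezout_coefficients_fst_snd)
  then show ?thesis by (rule that)
qed

text \<open>Otherwise a Bezout identity for \<open>m\<close> and \<open>q\<close>, evaluated at
  \<open>x\<close>, would read 0 = 1.\<close>

lemma rat_irreducible_root_dvd:
  fixes x :: "'a::field_char_0"
  assumes "irreducible m" "poly (rat_poly m) x = 0" "poly (rat_poly q) x = 0"
  shows "m dvd q"
proof (rule ccontr)
  assume "\<not> m dvd q"
  then obtain u v where uv: "u * m + v * q = 1" using bezout_irreducible assms(1) by blast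
  have "poly (rat_poly (u * m + v * q)) x = 0"
    using assms by (simp add: rat_poly_add rat_poly_mult)
  then show False by (simp add: uv)
qed

lemma ex_rat_min_poly:
  fixes x :: "'a::field_char_0"
  assumes "algebraic x"
  shows "\<exists>m. lead_coeff m = 1 \<and> irreducible m \<and> poly (rat_poly m) x = 0"
proof -
  define Z where "Z q \<longleftrightarrow> q \<noteq> 0 \<and> poly (rat_poly q) x = 0" for q :: "rat poly"
  obtain p0 where p0: "p0 \<noteq> 0" "poly (map_poly of_int p0) x = 0"
    using assms by (erule algebraicE')
  have "rat_poly (map_poly of_int p0) = (map_poly of_int p0 :: 'a poly)"
    by (simp add: map_poly_map_poly o_def)
  then have "Z (map_poly of_int p0)"
    using p0 by (simp add: Z_def map_poly_eq_0_iff)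
  then obtain p where p: "Z p" "\<And>q. Z q \<Longrightarrow> degree p \<le> degree q"
    using ex_has_least_nat[of Z _ degree] by blast
  define m where "m = smult (1 / lead_coeff p) p"
  have nz: "p \<noteq> 0" "m \<noteq> 0" "degree m = degree p" using p by (auto simp: Z_def m_def)
  have root: "poly (rat_poly m) x = 0"
    using p by (simp add: m_def Z_def map_poly_smult of_rat_mult)
  have "irreducible m"
  proof (rule irreducibleI)
    show "\<not> m dvd 1"
    proof
      assume "m dvd 1"
      then obtain c where c: "m = [:c:]" by (auto simp: is_unit_poly_iff)
      then have "c = 0" using root by (simp add: map_poly_pCons)
      then show False using nz c by simp
    qed
    fix a b assume ab: "m = a * b"
    \<comment> \<open>By minimality the factor that vanishes at \<open>x\<close> has full degree,
      which leaves a nonzero constant for the other one.\<close>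
    have *: "v dvd 1" if uv: "m = u * v" and u: "poly (rat_poly u) x = 0" for u v
    proof -
      have "u \<noteq> 0" "v \<noteq> 0" using nz uv by auto
      moreover from this u have "degree m \<le> degree u" using p(2)[of u] nz by (simp add: Z_def)
      ultimately have "degree v = 0" using uv by (simp add: degree_mult_eq)
      then show ?thesis using \<open>v \<noteq> 0\<close> by (simp add: is_unit_iff_degree)
    qed
    have "poly (rat_poly a) x = 0 \<or> poly (rat_poly b) x = 0"
      using root unfolding ab by (simp add: rat_poly_mult)
    then show "a dvd 1 \<or> b dvd 1"
      using *[of a b] *[of b a] ab by (auto simp: mult.commute)
  qed (use nz in auto)
  moreover have "lead_coeff m = 1" using nz by (simp add: m_def)
  ultimately show ?thesis using root by blast
qed

text \<open>Monic irreducible polynomials with the common root \<open>x\<close> divide each other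
  and so are equal; hence the definite description in \<open>rat_min_poly\<close> denotes.\<close>

lemma rat_min_poly:
  fixes x :: "'a::field_char_0"
  assumes "algebraic x"
  shows "lead_coeff (rat_min_poly x) = 1" "irreducible (rat_min_poly x)"
    "poly (rat_poly (rat_min_poly x)) x = 0"
proof -
  have "\<exists>!m. lead_coeff m = 1 \<and> irreducible m \<and> poly (rat_poly m) x = 0"
  proof (rule ex_ex1I[OF ex_rat_min_poly[OF assms]])
    fix m m' :: "rat poly"
    assume m: "lead_coeff m = 1 \<and> irreducible m \<and> poly (rat_poly m) x = 0"
      and m': "lead_coeff m' = 1 \<and> irreducible m' \<and> poly (rat_poly m') x = 0"
    then have "m dvd m'" "m' dvd m" using rat_irreducible_root_dvd by blast+
    moreover have "m \<noteq> 0" "m' \<noteq> 0" using m m' by auto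
    ultimately have deg: "degree m = degree m'" by (simp add: dvd_imp_degree_le order_antisym)
    obtain c where c: "m' = m * c" using \<open>m dvd m'\<close> by blast
    then have "degree c = 0" using deg \<open>m \<noteq> 0\<close> \<open>m' \<noteq> 0\<close>
      by (auto simp: degree_mult_eq)
    moreover have "lead_coeff c = 1"
      using arg_cong[OF c, of lead_coeff] m m' unfolding lead_coeff_mult by simp
    ultimately have "c = 1" by (auto elim: degree_eq_zeroE)
    then show "m = m'" using c by simp
  qed
  from theI'[OF this] show "lead_coeff (rat_min_poly x) = 1" "irreducible (rat_min_poly x)"
    "poly (rat_poly (rat_min_poly x)) x = 0"
    unfolding rat_min_poly_def by blast+
qed

text \<open>A multiple root is shared with the derivative, so \<open>m\<close> would divide
  \<open>pderiv m\<close>, which is impossible in characteristic 0. The conjugates are collected in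
  a set, and only because roots are simple does a product over that set recover
  \<open>m\<close>.\<close>

lemma rsquarefree_rat_irreducible:
  assumes "irreducible m"
  shows "rsquarefree (rat_poly m :: 'a::field_char_0 poly)"
  unfolding rsquarefree_roots
proof (intro allI notI)
  fix a :: 'a
  assume a: "poly (rat_poly m) a = 0 \<and> poly (pderiv (rat_poly m)) a = 0"
  have pd: "pderiv (rat_poly m) = (rat_poly (pderiv m) :: 'a poly)"
    by (rule poly_eqI) (simp add: coeff_map_poly coeff_pderiv of_rat_mult of_rat_add)
  have "m dvd pderiv m"
    using rat_irreducible_root_dvd[OF assms] a unfolding pd by blast
  moreover have "degree m > 0"
  proof (rule ccontr)
    assume "\<not> degree m > 0"
    then obtain c where "m = [:c:]" by (auto elim: degree_eq_zeroE)
    then show False using a assms by (auto simp: map_poly_pCons)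
  qed
  ultimately show False using not_dvd_pderiv[of m] by simp
qed

lemma poly_rat_irreducible_eq_prod:
  assumes "irreducible m" "lead_coeff m = 1"
  defines "C \<equiv> {\<alpha>::complex. poly (rat_poly m) \<alpha> = 0}"
  shows "poly (rat_poly m) z = (\<Prod>\<alpha>\<in>C. z - \<alpha>)" "finite C" "card C = degree m"
proof -
  let ?M = "rat_poly m :: complex poly"
  have "m \<noteq> 0" using assms by auto
  have d: "degree ?M = degree m" "lead_coeff ?M = 1" using assms(2)
    by (simp_all add: degree_map_poly coeff_map_poly)
  have M: "?M \<noteq> 0" using d by auto
  have eq: "(\<Prod>\<alpha>\<in>C. [:- \<alpha>, 1:]) = ?M"
    using complex_poly_decompose_rsquarefree[OF rsquarefree_rat_irreducible[OF assms(1)]] d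
    by (simp add: C_def)
  show "finite C" unfolding C_def using M by (rule poly_roots_finite)
  show "poly ?M z = (\<Prod>\<alpha>\<in>C. z - \<alpha>)"
    unfolding eq[symmetric] by (simp add: poly_prod)
  show "card C = degree m"
    unfolding d(1)[symmetric] eq[symmetric] by (subst degree_prod_sum_eq) auto
qed

section \<open>Integrality of monic rational factors\<close>

lemma clear_denominators:
  obtains d :: int and P where "d > 0" "smult (of_int d) q = map_poly rat_of_int P"
proof -
  have "\<exists>d>0. \<exists>P. smult (of_int d) q = map_poly rat_of_int P"
  proof (induction q rule: pCons_induct)
    case 0
    have "smult (of_int 1) 0 = map_poly rat_of_int 0" by simp
    then show ?case using zero_less_one by blast
  next
    case (pCons a q)
    then obtain d P where dP: "d > 0" "smult (of_int d) q = map_poly rat_of_int P" by blast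
    obtain n e where ne: "quotient_of a = (n, e)" by fastforce
    have e: "e > 0" "a = of_int n / of_int e"
      using quotient_of_denom_pos[OF ne] quotient_of_div[OF ne] by auto
    have "smult (of_int (d * e)) (pCons a q) = pCons (of_int (d * n)) (smult (of_int e) (smult (of_int d) q))"
      using e by (simp add: mult.commute)
    also have "\<dots> = map_poly rat_of_int (pCons (d * n) (smult e P))"
      unfolding dP by (simp add: map_poly_pCons map_poly_smult)
    finally show ?case using dP(1) e(1) mult_pos_pos by blast
  qed
  then show ?thesis using that by blast
qed

text \<open>Gauss's lemma. Cleared of denominators, the factorisation reads
  \<open>P * Q = smult (d * e) F\<close> with \<open>F\<close> primitive; contents multiply, so the
  scalar is the product of the contents and the primitive parts multiply to
  \<open>F\<close>.\<close>

lemma monic_dvd_int_poly: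
  fixes F :: "int poly"
  assumes m: "lead_coeff m = 1" and dvd: "m dvd map_poly rat_of_int F" and F: "lead_coeff F = 1"
  obtains P Q where "m = map_poly rat_of_int P" "F = P * Q"
proof -
  have inj: "p = q" if "map_poly rat_of_int p = map_poly rat_of_int q" for p q
    using that by (simp add: poly_eq_iff coeff_map_poly)
  have smult: "map_poly rat_of_int (smult c p) = smult (of_int c) (map_poly rat_of_int p)" for c p
    by (simp add: map_poly_smult)
  obtain q where q: "map_poly rat_of_int F = m * q" using dvd by blast
  obtain d P where dP: "d > 0" "smult (of_int d) m = map_poly rat_of_int P"
    by (rule clear_denominators)
  obtain e Q where eQ: "e > 0" "smult (of_int e) q = map_poly rat_of_int Q"
    by (rule clear_denominators)
  have "map_poly rat_of_int (smult (d * e) F) = map_poly rat_of_int (P * Q)"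
    by (simp add: smult int_poly_mult q mult.commute flip: dP(2) eQ(2))
  then have PQ: "smult (d * e) F = P * Q" by (rule inj)
  have cF: "Polynomial.content F = 1"
  proof -
    have "is_unit (Polynomial.content F)" using content_dvd_coeff[of F "degree F"] F by simp
    then show ?thesis using normalize_content[of F] by (simp add: is_unit_normalize)
  qed
  have c: "Polynomial.content P * Polynomial.content Q = d * e"
    using arg_cong[OF PQ, of Polynomial.content] dP(1) eQ(1) by (simp add: content_mult cF)
  define P' Q' where "P' = primitive_part P" and "Q' = primitive_part Q"
  have P': "P = smult (Polynomial.content P) P'" and Q': "Q = smult (Polynomial.content Q) Q'"
    by (simp_all add: P'_def Q'_def)
  have "P * Q = smult (d * e) (P' * Q')"
    by (subst P', subst Q') (simp add: mult.commute flip: c)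
  then have "smult (d * e) F = smult (d * e) (P' * Q')" using PQ by simp
  then have "smult (d * e) (F - P' * Q') = 0" by (simp add: smult_diff_right)
  then have FPQ: "F = P' * Q'" using dP(1) eQ(1) by (simp only: smult_eq_0_iff) auto
  have "lead_coeff P' * lead_coeff Q' = 1" using F by (simp add: FPQ lead_coeff_mult)
  then have l: "lead_coeff P' = 1 \<or> lead_coeff P' = -1" by (auto simp: zmult_eq_1_iff)
  \<comment> \<open>Leading coefficients identify \<open>d\<close> with the content of
    \<open>P\<close>: that of \<open>P'\<close> is 1 or -1, and neither \<open>d\<close> nor the
    content is negative.\<close>
  have "lead_coeff (smult (of_int d) m) = rat_of_int d"
    by (simp only: lead_coeff_smult m mult_1_right)
  moreover have "lead_coeff (map_poly rat_of_int P) = rat_of_int (lead_coeff P)"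
    by (simp add: degree_map_poly coeff_map_poly)
  ultimately have "d = lead_coeff P" using dP(2) by simp
  also have "\<dots> = Polynomial.content P * lead_coeff P'" by (metis lead_coeff_smult P')
  finally have dl: "d = Polynomial.content P * lead_coeff P'" .
  have "Polynomial.content P \<ge> 0" using normalize_content[of P] by (simp add: normalize_int_def)
  then have "d = Polynomial.content P" using dl l dP(1) by auto
  then have "smult (of_int d) m = smult (of_int d) (map_poly rat_of_int P')"
    using dP(2) P' smult by metis
  then have "smult (of_int d) (m - map_poly rat_of_int P') = 0" by (simp add: smult_diff_right)
  then have "m = map_poly rat_of_int P'" using dP(1) by (simp only: smult_eq_0_iff) auto
  then show ?thesis using FPQ by (rule that)
qed

section \<open>Divisibility of the value at 1 by \<open>p\<close>\<close>

lemma prime_dvd_choose_prime_power: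
  fixes p :: nat
  assumes "prime p" "0 < i" "i < p ^ r"
  shows "p dvd (p ^ r choose i)"
proof (rule ccontr)
  assume "\<not> p dvd (p ^ r choose i)"
  then have "coprime (p ^ r) (p ^ r choose i)" using assms(1) by (simp add: prime_imp_coprime)
  \<comment> \<open>Absorption: i * (N choose i) = N * (N - 1 choose i - 1) for N =
    \<open>p ^ r\<close>.\<close>
  moreover have "p ^ r dvd i * (p ^ r choose i)"
    using times_binomial_minus1_eq[of i "p ^ r"] assms(2) by simp
  ultimately have "p ^ r dvd i" by (simp add: coprime_dvd_mult_left_iff)
  then show False using assms by (auto dest: dvd_imp_le)
qed

text \<open>In the variable \<open>y = x - 1\<close> the polynomial \<open>x ^ p ^ r - a\<close> is \<open>y ^ p ^ r\<close> modulo \<open>p\<close>,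
  so the argument of Eisenstein's criterion applies.\<close>

lemma prime_dvd_poly_1:
  fixes P Q :: "int poly" and p :: nat
  assumes p: "prime p" and a: "[a = 1] (mod int p)"
    and PQ: "P * Q = monom 1 (p ^ r) - [:a:]" and P: "degree P > 0"
  shows "int p dvd poly P 1"
proof -
  let ?s = "[:1, 1:] :: int poly"
  define P1 Q1 where "P1 = pcompose P ?s" and "Q1 = pcompose Q ?s"
  have N: "p ^ r > 0" using p by (simp add: prime_gt_0_nat)
  have deg: "degree (monom 1 (p ^ r) - [:a:]) = p ^ r"
    using N by (subst diff_conv_add_uminus, subst degree_add_eq_left) (auto simp: degree_monom_eq)
  have "P \<noteq> 0" "Q \<noteq> 0" using PQ deg N by auto
  then have dQ: "degree Q < p ^ r" using P arg_cong[OF PQ, of degree] deg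
    by (simp add: degree_mult_eq)
  have "lead_coeff P * lead_coeff Q = 1"
    using arg_cong[OF PQ, of lead_coeff] N unfolding lead_coeff_mult deg
    by (auto simp: coeff_pCons split: nat.splits)
  then have "\<bar>lead_coeff Q\<bar> = 1" by (auto simp: zmult_eq_1_iff)
  then have "\<not> int p dvd lead_coeff Q" using p
    by (metis abs_dvd_iff dvd_abs_iff int_dvd_int_iff not_prime_unit of_nat_1)
  moreover have "lead_coeff Q1 = lead_coeff Q" unfolding Q1_def by (subst lead_coeff_comp) auto
  moreover have dQ1: "degree Q1 = degree Q" by (simp add: Q1_def degree_pcompose)
  ultimately have ex: "\<not> int p dvd coeff Q1 (degree Q)" by simp
  \<comment> \<open>As in Eisenstein's argument, \<open>i\<close> is the lowest coefficient of
    \<open>Q1\<close> not divisible by \<open>p\<close>. It exists because the leading coefficient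
    is a unit, and it is below \<open>p ^ r\<close> because \<open>P\<close> is not
    constant.\<close>
  define i where "i = (LEAST i. \<not> int p dvd coeff Q1 i)"
  have i: "\<not> int p dvd coeff Q1 i" unfolding i_def by (rule LeastI[of _ "degree Q"]) (rule ex)
  have less: "int p dvd coeff Q1 j" if "j < i" for j using not_less_Least that unfolding i_def
    by blast
  have "i \<le> degree Q" unfolding i_def by (rule Least_le) (rule ex)
  then have iN: "i < p ^ r" using dQ by simp
  have prod: "P1 * Q1 = ?s ^ (p ^ r) - [:a:]"
  proof -
    have monom: "pcompose (monom 1 n) ?s = ?s ^ n" for n
      by (induction n) (simp_all add: monom_0 monom_Suc pcompose_pCons)
    have "P1 * Q1 = pcompose (P * Q) ?s" by (simp add: P1_def Q1_def pcompose_mult)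
    also have "\<dots> = ?s ^ (p ^ r) - [:a:]"
      unfolding PQ by (simp add: pcompose_diff monom)
    finally show ?thesis .
  qed
  have "int p dvd coeff (P1 * Q1) i"
  \<comment> \<open>The constant coefficient of (y + 1)^N - a is 1 - a, and those strictly between 0
    and N are binomial coefficients; the top coefficient 1 is excluded by \<open>iN\<close>.\<close>
  proof (cases "i = 0")
    case True
    then show ?thesis using a unfolding prod
      by (simp add: coeff_0_power cong_iff_dvd_diff dvd_diff_commute)
  next
    case False
    have "coeff (P1 * Q1) i = int (p ^ r choose i)"
      unfolding prod using False iN
      by (simp add: coeff_linear_poly_power coeff_pCons split: nat.split)
    then show ?thesis using prime_dvd_choose_prime_power[OF p _ iN] False by simp
  qed
  also have "coeff (P1 * Q1) i = coeff P1 0 * coeff Q1 i + (\<Sum>j\<in>{1..i}. coeff P1 j * coeff Q1 (i - j))"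
    by (simp add: coeff_mult atMost_atLeast0 sum.atLeast_Suc_atMost)
  finally have "int p dvd coeff P1 0 * coeff Q1 i"
    by (rule dvd_add_left_iff[THEN iffD1, rotated]) (auto intro!: dvd_sum dvd_mult less)
  then have "int p dvd coeff P1 0" using i p by (auto simp: prime_dvd_mult_iff)
  also have "coeff P1 0 = poly P 1" by (simp add: P1_def poly_0_coeff_0[symmetric] poly_pcompose)
  finally show ?thesis .
qed

lemma of_real_of_rat: "of_real (of_rat q) = (of_rat q :: 'a::real_field)"
  by (cases q) (simp add: of_rat_rat)

lemma prime_le_abs_min_poly_1:
  fixes x :: "'a::field_char_0"
  assumes "algebraic x" "prime p" "x ^ (p ^ r) = of_nat a" "[a = 1] (mod p)" "x \<noteq> 1"
  shows "rat_of_nat p \<le> \<bar>poly (rat_min_poly x) 1\<bar>"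
proof -
  let ?m = "rat_min_poly x"
  note m = rat_min_poly[OF assms(1)]
  define F where "F = monom 1 (p ^ r) - [:int a:]"
  have N: "p ^ r > 0" using assms(2) by (simp add: prime_gt_0_nat)
  have deg: "degree F = p ^ r"
    unfolding F_def using N
    by (subst diff_conv_add_uminus, subst degree_add_eq_left) (auto simp: degree_monom_eq)
  have "lead_coeff F = 1"
    unfolding deg using N by (auto simp: F_def coeff_pCons split: nat.splits)
  moreover have "?m dvd map_poly rat_of_int F"
  proof (rule rat_irreducible_root_dvd[OF m(2,3)])
    have "rat_poly (map_poly rat_of_int F) = (map_poly of_int F :: 'a poly)"
      by (simp add: map_poly_map_poly o_def)
    also have "\<dots> = monom 1 (p ^ r) - [:of_nat a:]"
      by (rule poly_eqI) (simp add: F_def coeff_map_poly coeff_pCons split: nat.splits)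
    finally show "poly (rat_poly (map_poly rat_of_int F)) x = 0"
      using assms(3) by (simp add: poly_monom)
  qed
  ultimately obtain P Q where PQ: "?m = map_poly rat_of_int P" "F = P * Q"
    using m(1) monic_dvd_int_poly by metis
  have "degree ?m > 0"
  proof (rule ccontr)
    assume "\<not> degree ?m > 0"
    then obtain c where "?m = [:c:]" by (auto elim: degree_eq_zeroE)
    then have "?m = 1" using m(1) by simp
    then show False using m(2) by simp
  qed
  then have dP: "degree P > 0" unfolding PQ(1) by (simp add: degree_map_poly)
  have "int p dvd poly P 1"
    using assms(2) _ PQ(2)[symmetric, unfolded F_def] dP
  proof (rule prime_dvd_poly_1)
    show "[int a = 1] (mod int p)" using assms(4) cong_int_iff[of a 1 p] by simp
  qed
  moreover have m1: "poly ?m 1 = rat_of_int (poly P 1)"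
    unfolding PQ(1) by (simp add: poly_altdef degree_map_poly coeff_map_poly)
  \<comment> \<open>An irreducible polynomial with the rational root 1 is a multiple of X - 1, and
    then its root \<open>x\<close> would be 1.\<close>
  moreover have "poly ?m 1 \<noteq> 0"
  proof
    assume "poly ?m 1 = 0"
    then have "[:-1, 1:] dvd ?m" by (simp add: poly_eq_0_iff_dvd)
    then obtain q where q: "?m = [:-1, 1:] * q" by blast
    have "q dvd 1"
      using irreducibleD[OF m(2) q] by (auto simp: is_unit_poly_iff)
    then obtain c where c: "q = [:c:]" by (auto simp: is_unit_poly_iff)
    then have "c \<noteq> 0" using q m(1) by auto
    have "?m = [:-c, c:]" using q c by simp
    then have "poly (rat_poly [:-c, c:]) x = 0" using m(3) by (simp only:)
    then have "of_rat c * (x - 1) = 0" by (simp add: map_poly_pCons of_rat_minus algebra_simps)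
    then show False using \<open>c \<noteq> 0\<close> assms(5) by simp
  qed
  ultimately have "int p \<le> \<bar>poly P 1\<bar>" by (intro zdvd_imp_le) auto
  then have "rat_of_int (int p) \<le> rat_of_int \<bar>poly P 1\<bar>" by (simp only: of_int_le_iff)
  then show ?thesis by (simp add: m1)
qed

section \<open>Bounding the value at 1 by the conjugates\<close>

lemma abs_min_poly_1_le:
  fixes x R :: real
  assumes "algebraic x"
    and R: "\<And>\<alpha>. \<alpha> \<in> rat_conjugates x \<Longrightarrow> \<alpha> \<noteq> complex_of_real x \<Longrightarrow> cmod \<alpha> < R"
  shows "real_of_rat \<bar>poly (rat_min_poly x) 1\<bar> \<le> \<bar>x - 1\<bar> * (R + 1) ^ (degree (rat_min_poly x) - 1)"
proof -
  let ?m = "rat_min_poly x"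
  let ?C = "rat_conjugates x"
  note m = rat_min_poly[OF assms(1)]
  have C: "poly (rat_poly ?m) z = (\<Prod>\<alpha>\<in>?C. z - \<alpha>)" "finite ?C" "card ?C = degree ?m" for z
    unfolding rat_conjugates_def by (fact poly_rat_irreducible_eq_prod[OF m(2,1)])+
  have ev: "poly (rat_poly ?m) (of_real y) = complex_of_real (poly (rat_poly ?m) y)" for y
    by (simp add: poly_altdef degree_map_poly coeff_map_poly of_real_of_rat)
  have "poly (rat_poly ?m) (complex_of_real x) = 0" by (simp add: ev m(3))
  then have xC: "complex_of_real x \<in> ?C" by (simp add: rat_conjugates_def)
  have "complex_of_real (real_of_rat (poly ?m 1)) = (\<Prod>\<alpha>\<in>?C. 1 - \<alpha>)"
    unfolding C(1)[of 1, symmetric] using ev[of 1]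
    by (simp add: poly_altdef degree_map_poly coeff_map_poly of_rat_sum)
  then have "\<bar>real_of_rat (poly ?m 1)\<bar> = (\<Prod>\<alpha>\<in>?C. cmod (1 - \<alpha>))"
    by (metis norm_of_real prod_norm)
  \<comment> \<open>The factor of \<open>x\<close> is kept exact, because \<open>R\<close> bounds
    only the other conjugates.\<close>
  also have "\<dots> = cmod (1 - complex_of_real x) * (\<Prod>\<alpha>\<in>?C - {complex_of_real x}. cmod (1 - \<alpha>))"
    by (rule prod.remove[OF C(2) xC])
  also have "cmod (1 - complex_of_real x) = \<bar>x - 1\<bar>"
    by (metis abs_minus_commute norm_of_real of_real_1 of_real_diff)
  also have "(\<Prod>\<alpha>\<in>?C - {complex_of_real x}. cmod (1 - \<alpha>)) \<le> (\<Prod>\<alpha>\<in>?C - {complex_of_real x}. R + 1)"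
  proof (intro prod_mono conjI norm_ge_zero)
    fix \<alpha> assume "\<alpha> \<in> ?C - {complex_of_real x}"
    then have "cmod \<alpha> < R" using R by auto
    then show "cmod (1 - \<alpha>) \<le> R + 1" using norm_triangle_ineq4[of 1 \<alpha>] by simp
  qed
  also have "\<dots> = (R + 1) ^ (degree ?m - 1)" using C xC by simp
  finally show ?thesis by (simp add: mult_left_mono)
qed

section \<open>The degree of the field generated by an algebraic number\<close>

lemma rat_adjoin_power: "x ^ i \<in> rat_adjoin x"
proof (induction i)
  case 0
  show ?case using generate_field.one[of ring_of_type_algebra "{x}"]
    by (simp add: rat_adjoin_def ring_of_type_algebra_def)
next
  case (Suc i)
  have "x \<in> rat_adjoin x" unfolding rat_adjoin_def by (rule generate_field.incl) simp
  then show ?case using generate_field.eng_mult[of x ring_of_type_algebra "{x}" "x ^ i"] Suc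
    by (simp add: rat_adjoin_def ring_of_type_algebra_def)
qed

text \<open>Polynomial expressions in \<open>x\<close> already form a field: \<open>m\<close> is
  irreducible, so a Bezout identity with \<open>m\<close> provides the inverse of a nonzero
  value.\<close>

lemma rat_adjoin_poly:
  fixes x :: "'a::field_char_0"
  assumes "irreducible m" "poly (rat_poly m) x = 0" "y \<in> rat_adjoin x"
  shows "\<exists>q. y = poly (rat_poly q) x"
  using assms(3) unfolding rat_adjoin_def
proof (induction rule: generate_field.induct)
  case one
  show ?case by (rule exI[of _ 1]) (simp add: ring_of_type_algebra_def)
next
  case (incl h)
  then show ?case by (intro exI[of _ "[:0, 1:]"]) (simp add: map_poly_pCons)
next
  case (a_inv h)
  interpret field "ring_of_type_algebra :: 'a ring" ..
  have "\<ominus>\<^bsub>ring_of_type_algebra\<^esub> h = - h"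
    by (rule minus_equality) (simp_all add: ring_of_type_algebra_def)
  moreover obtain q where "h = poly (rat_poly q) x" using a_inv by blast
  ultimately have "\<ominus>\<^bsub>ring_of_type_algebra\<^esub> h = poly (rat_poly ([:-1:] * q)) x"
    unfolding rat_poly_mult by (simp add: map_poly_pCons)
  then show ?case by blast
next
  case (m_inv h)
  interpret field "ring_of_type_algebra :: 'a ring" ..
  have h: "h \<noteq> 0" using m_inv by (simp add: ring_of_type_algebra_def)
  then have "inv\<^bsub>ring_of_type_algebra\<^esub> h = inverse h"
    by (intro comm_inv_char) (simp_all add: ring_of_type_algebra_def)
  moreover obtain q where q: "h = poly (rat_poly q) x" using m_inv by blast
  have "\<not> m dvd q"
  proof
    assume "m dvd q"
    then obtain r where "q = m * r" by blast
    then show False using q h assms(2) by (simp add: rat_poly_mult)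
  qed
  then obtain u v where uv: "u * m + v * q = 1" using bezout_irreducible assms(1) by blast
  have "poly (rat_poly (u * m + v * q)) x = 1" unfolding uv by simp
  then have "poly (rat_poly v) x * h = 1" using assms(2) q by (simp add: rat_poly_add rat_poly_mult)
  then have "inverse h = poly (rat_poly v) x" by (metis h inverse_unique mult.commute)
  ultimately show ?case by auto
next
  case (eng_add h1 h2)
  then obtain q1 q2 where "h1 = poly (rat_poly q1) x" "h2 = poly (rat_poly q2) x" by blast
  then show ?case by (intro exI[of _ "q1 + q2"]) (simp add: rat_poly_add ring_of_type_algebra_def)
next
  case (eng_mult h1 h2)
  then obtain q1 q2 where "h1 = poly (rat_poly q1) x" "h2 = poly (rat_poly q2) x" by blast
  then show ?case by (intro exI[of _ "q1 * q2"]) (simp add: rat_poly_mult ring_of_type_algebra_def)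
qed

text \<open>The powers of \<open>x\<close> below the degree form a basis: remainders modulo the
  minimal polynomial make them span, and no nonzero polynomial of smaller degree vanishes at
  \<open>x\<close>. Thus the field-theoretic exponent becomes the degree that counts
  conjugates.\<close>

lemma rat_ext_degree_eq:
  fixes x :: "'a::field_char_0"
  assumes "algebraic x"
  shows "rat_ext_degree x = degree (rat_min_poly x)"
proof -
  interpret V: vector_space "\<lambda>(q::rat) (v::'a). of_rat q * v"
    by unfold_locales (simp_all add: algebra_simps of_rat_add of_rat_mult)
  let ?m = "rat_min_poly x"
  note m = rat_min_poly[OF assms]
  define B where "B = (\<lambda>i. x ^ i) ` {..<degree ?m}"
  have small: "q = 0" if "poly (rat_poly q) x = 0" "degree q < degree ?m" for q
    using rat_irreducible_root_dvd[OF m(2,3) that(1)] dvd_imp_degree_le[of ?m q] that(2) by auto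
  have deg: "degree ?m > 0"
  proof (rule ccontr)
    assume "\<not> degree ?m > 0"
    then obtain c where c: "?m = [:c:]" by (auto elim: degree_eq_zeroE)
    then have "c = 1" using m(1) by simp
    then show False using m(2) c by (simp add: one_pCons[symmetric])
  qed
  \<comment> \<open>\<open>B\<close> is a set of values, so its cardinality is the degree only if
    the powers are distinct.\<close>
  have inj: "inj_on (\<lambda>i. x ^ i) {..<degree ?m}"
  proof (rule linorder_inj_onI')
    fix i j assume ij: "i \<in> {..<degree ?m}" "j \<in> {..<degree ?m}" "i < j"
    let ?q = "monom 1 i - monom 1 j :: rat poly"
    show "x ^ i \<noteq> x ^ j"
    proof
      assume "x ^ i = x ^ j"
      moreover have "rat_poly ?q = (monom 1 i - monom 1 j :: 'a poly)"
        by (rule poly_eqI) (simp add: coeff_map_poly of_rat_diff)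
      ultimately have "poly (rat_poly ?q) x = 0" by (simp add: poly_monom)
      moreover have "degree ?q < degree ?m"
        using ij by (intro degree_diff_less) (auto simp: degree_monom_eq)
      ultimately have "?q = 0" by (rule small)
      then have "coeff ?q i = 0" by simp
      then show False using ij by simp
    qed
  qed
  have "V.dim (rat_adjoin x) = degree ?m"
  proof (rule V.dim_unique)
    show "B \<subseteq> rat_adjoin x" using rat_adjoin_power by (auto simp: B_def)
    show "card B = degree ?m" unfolding B_def using inj by (simp add: card_image)
    show "rat_adjoin x \<subseteq> V.span B"
    proof
      fix y assume "y \<in> rat_adjoin x"
      then obtain q where q: "y = poly (rat_poly q) x" using rat_adjoin_poly[OF m(2,3)] by blast
      define r where "r = q mod ?m"
      have "q = q div ?m * ?m + r" by (simp add: r_def)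
      then have "y = poly (rat_poly r) x"
        unfolding q using m(3)
        by (metis add_0 mult_zero_right poly_add poly_mult rat_poly_add rat_poly_mult)
      also have "\<dots> = (\<Sum>i\<le>degree r. of_rat (coeff r i) * x ^ i)"
        by (simp add: poly_altdef degree_map_poly coeff_map_poly)
      finally have y: "y = (\<Sum>i\<le>degree r. of_rat (coeff r i) * x ^ i)" .
      have "degree r < degree ?m" using degree_mod_less[of ?m q] deg
        by (cases "r = 0"; cases "?m = 0") (auto simp: r_def)
      then have "x ^ i \<in> B" if "i \<le> degree r" for i using that by (auto simp: B_def)
      then show "y \<in> V.span B" unfolding y by (intro V.span_sum V.span_scale V.span_base) auto
    qed
    show "V.independent B"
    proof
      assume "V.dependent B"
      moreover have "finite B" by (simp add: B_def)
      ultimately obtain u where u: "\<exists>v\<in>B. u v \<noteq> 0" "(\<Sum>v\<in>B. of_rat (u v) * v) = 0"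
        using V.dependent_finite by auto
      define q where "q = (\<Sum>i<degree ?m. monom (u (x ^ i)) i)"
      have c: "coeff q i = (if i < degree ?m then u (x ^ i) else 0)" for i
        by (simp add: q_def coeff_sum)
      have dq: "degree q < degree ?m"
        using deg by (intro degree_lessI) (auto simp: c)
      have "poly (rat_poly q) x = (\<Sum>i<degree ?m. of_rat (coeff q i) * x ^ i)"
        unfolding poly_altdef degree_map_poly
        using dq by (intro sum.mono_neutral_cong_left) (auto simp: coeff_map_poly coeff_eq_0 degree_map_poly)
      also have "\<dots> = (\<Sum>v\<in>B. of_rat (u v) * v)"
        unfolding B_def using inj by (simp add: sum.reindex c)
      finally have "q = 0" using u(2) dq by (intro small) auto
      then have "u (x ^ i) = 0" if "i < degree ?m" for i using c[of i] that by simp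
      then show False using u(1) by (auto simp: B_def)
    qed
  qed
  then show ?thesis by (simp add: rat_ext_degree_def)
qed

section \<open>Existence of the limit\<close>

abbreviation torus_box :: "nat \<Rightarrow> nat \<Rightarrow> (nat \<Rightarrow> int) set" where
  "torus_box d n \<equiv> {..<d} \<rightarrow>\<^sub>E {0..<int n}"

text \<open>The edges of the whole grid, not of one box: independence tests only pairs inside the
  set, so one translation-invariant edge set serves boxes of every side.\<close>

definition box_edges :: "nat \<Rightarrow> (nat \<Rightarrow> int) set set" where
  "box_edges d = {{x, x(i := x i + 1)} | x i. i < d}"

definition num_indep_box :: "nat \<Rightarrow> nat \<Rightarrow> nat" where
  "num_indep_box d n = card (independent_sets (torus_box d n) (box_edges d))"

lemma carrier_torus_group: "n > 0 \<Longrightarrow> carrier (torus_group d n) = torus_box d n"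
  by (simp add: torus_group_def carrier_integer_mod_group)

lemma mult_torus_group: "x \<otimes>\<^bsub>torus_group d n\<^esub> y = (\<lambda>j\<in>{..<d}. (x j + y j) mod int n)"
  by (simp add: torus_group_def)

lemma one_torus_group: "\<one>\<^bsub>torus_group d n\<^esub> = (\<lambda>j\<in>{..<d}. 0)"
  by (simp add: torus_group_def)

lemma comm_group_torus_group: "comm_group (torus_group d n)"
proof (rule group.group_comm_groupI)
  show "group (torus_group d n)" by (simp add: torus_group_def)
qed (simp add: mult_torus_group add.commute)

lemma finite_torus_box: "finite (torus_box d n)"
  by (intro finite_PiE) auto

lemma card_torus_box: "card (torus_box d n) = n ^ d"
  by (simp add: card_PiE)

lemma torus_basis_in_carrier: "n > 0 \<Longrightarrow> torus_basis d n i \<in> torus_box d n"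
  by (auto simp: torus_basis_def)

lemma inv_torus_basis:
  assumes "n > 0"
  shows "inv\<^bsub>torus_group d n\<^esub> torus_basis d n i = (\<lambda>j\<in>{..<d}. if j = i then - 1 mod int n else 0)"
proof -
  have "inv\<^bsub>torus_group d n\<^esub> torus_basis d n i
      = (\<lambda>j\<in>{..<d}. inv\<^bsub>integer_mod_group n\<^esub> torus_basis d n i j)"
    unfolding torus_group_def using torus_basis_in_carrier[OF assms] assms
    by (intro inv_product_group) (auto simp: carrier_integer_mod_group)
  also have "\<dots> = (\<lambda>j\<in>{..<d}. if j = i then - 1 mod int n else 0)"
    using assms by (intro restrict_ext) (auto simp: carrier_integer_mod_group torus_basis_def mod_minus_eq)
  finally show ?thesis .
qed

lemma mult_torus_basis:
  assumes "x \<in> torus_box d n" "i < d"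
  shows "x \<otimes>\<^bsub>torus_group d n\<^esub> torus_basis d n i = x(i := (x i + 1) mod int n)"
proof
  fix j
  show "(x \<otimes>\<^bsub>torus_group d n\<^esub> torus_basis d n i) j = (x(i := (x i + 1) mod int n)) j"
    using assms by (cases "j < d") (auto simp: mult_torus_group torus_basis_def mod_simps PiE_iff extensional_def)
qed

lemma mult_inv_torus_basis:
  assumes "x \<in> torus_box d n" "i < d"
  shows "x \<otimes>\<^bsub>torus_group d n\<^esub> (inv\<^bsub>torus_group d n\<^esub> torus_basis d n i) = x(i := (x i - 1) mod int n)"
proof -
  have n: "n > 0" using assms by (cases "n = 0") (auto simp: PiE_iff)
  show ?thesis
  proof
    fix j
    show "(x \<otimes>\<^bsub>torus_group d n\<^esub> (inv\<^bsub>torus_group d n\<^esub> torus_basis d n i)) j = (x(i := (x i - 1) mod int n)) j"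
      unfolding inv_torus_basis[OF n] using assms
      by (cases "j < d") (auto simp: mult_torus_group mod_simps PiE_iff extensional_def)
  qed
qed

lemma torus_basis_in_gens:
  assumes "n \<ge> 2" "i < d"
  shows "torus_basis d n i \<in> torus_gens d n"
proof -
  have "torus_basis d n i i \<noteq> \<one>\<^bsub>torus_group d n\<^esub> i"
    using assms by (simp add: torus_basis_def one_torus_group)
  then show ?thesis using assms by (auto simp: torus_gens_def)
qed

section \<open>Comparison of the torus with boxes\<close>

lemma num_indep_le_box:
  assumes "n > 0"
  shows "num_indep d n \<le> num_indep_box d n"
proof -
  have "{x, y} \<in> torus_edges d n"
    if "{x, y} \<in> box_edges d" and xy: "x \<in> torus_box d n" "y \<in> torus_box d n" for x y
  proof -
    obtain z i where z: "i < d" "{x, y} = {z, z(i := z i + 1)}"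
      using \<open>{x, y} \<in> box_edges d\<close> by (auto simp: box_edges_def)
    have zV: "z \<in> torus_box d n" "z(i := z i + 1) \<in> torus_box d n"
      using z(2) xy by (auto simp: doubleton_eq_iff)
    \<comment> \<open>Both ends lie in the box, so its side is at least 2 and adding 1 does not wrap
      around.\<close>
    have zi: "z i \<ge> 0" "z i + 1 < int n"
      using zV z(1) by (auto simp: PiE_iff dest!: bspec[of _ _ i])
    have "z \<otimes>\<^bsub>torus_group d n\<^esub> torus_basis d n i = z(i := z i + 1)"
      unfolding mult_torus_basis[OF zV(1) z(1)] using zi by simp
    moreover have "torus_basis d n i \<in> torus_gens d n" using zi z(1)
      by (intro torus_basis_in_gens) auto
    ultimately show ?thesis
      unfolding z(2) torus_edges_def cayley_edges_def
      using zV(1) carrier_torus_group[OF assms, of d]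
      by (metis (mono_tags, lifting) mem_Collect_eq)
  qed
  then have "independent_sets (torus_box d n) (torus_edges d n) \<subseteq> independent_sets (torus_box d n) (box_edges d)"
    unfolding independent_sets_def by blast
  moreover have "finite (independent_sets (torus_box d n) (box_edges d))"
    by (intro finite_independent_sets finite_torus_box)
  ultimately show ?thesis
    unfolding num_indep_def num_indep_box_def carrier_torus_group[OF assms] by (intro card_mono)
qed

text \<open>A torus with one layer more than the box has no wrap-around edge with both ends in the
  box, so its edges inside the box are grid edges.\<close>

lemma num_indep_box_le:
  "num_indep_box d n \<le> num_indep d (Suc n)"
proof -
  have no: False if I: "I \<subseteq> torus_box d n" "\<forall>x\<in>I. \<forall>y\<in>I. {x, y} \<notin> box_edges d"
    and xy: "x \<in> I" "y \<in> I" and "{x, y} \<in> torus_edges d (Suc n)" for I x y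
  proof -
    let ?G = "torus_group d (Suc n)"
    obtain z s where z: "s \<in> torus_gens d (Suc n)" "{x, y} = {z, z \<otimes>\<^bsub>?G\<^esub> s}"
      using \<open>{x, y} \<in> torus_edges d (Suc n)\<close>
      by (auto simp: torus_edges_def cayley_edges_def)
    then have zI: "z \<in> I" "z \<otimes>\<^bsub>?G\<^esub> s \<in> I" using xy
      by (auto simp: doubleton_eq_iff)
    have zn: "z \<in> torus_box d n" "z \<otimes>\<^bsub>?G\<^esub> s \<in> torus_box d n"
      using zI I(1) by auto
    have zV: "z \<in> torus_box d (Suc n)" using zn by (force simp: PiE_iff)
    obtain i where i: "i < d" "s = torus_basis d (Suc n) i \<or> s = inv\<^bsub>?G\<^esub> torus_basis d (Suc n) i"
      using z(1) by (auto simp: torus_gens_def)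
    have zi: "0 \<le> z i" "z i < int n" using zn i by (auto simp: PiE_iff)
    from i(2) show False
    proof
      assume "s = torus_basis d (Suc n) i"
      then have "z \<otimes>\<^bsub>?G\<^esub> s = z(i := z i + 1)"
        using mult_torus_basis[OF zV i(1)] zi by simp
      then show False using I(2) zI i(1) by (auto simp: box_edges_def)
    next
      assume "s = inv\<^bsub>?G\<^esub> torus_basis d (Suc n) i"
      then have eq: "z \<otimes>\<^bsub>?G\<^esub> s = z(i := (z i - 1) mod int (Suc n))"
        using mult_inv_torus_basis[OF zV i(1)] by simp
      define w where "w = z \<otimes>\<^bsub>?G\<^esub> s"
      have "w \<in> torus_box d n" using zn(2) by (simp add: w_def)
      then have "w i < int n" using i(1) by (simp add: PiE_iff)
      \<comment> \<open>Stepping down from coordinate 0 would land on coordinate \<open>n\<close>,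
        in the layer outside the box.\<close>
      have "z i \<noteq> 0"
      proof
        assume "z i = 0"
        then have "w i = int n" by (simp add: w_def eq zmod_minus1)
        with \<open>w i < int n\<close> show False by simp
      qed
      then have "w = z(i := z i - 1)" using zi by (simp add: w_def eq)
      then have "z = w(i := w i + 1)" by auto
      then have "{w, z} \<in> box_edges d" using i(1) by (auto simp: box_edges_def)
      then show False using I(2) zI by (simp add: w_def)
    qed
  qed
  have "torus_box d n \<subseteq> torus_box d (Suc n)" by (intro PiE_mono) auto
  with no have "independent_sets (torus_box d n) (box_edges d)
      \<subseteq> independent_sets (torus_box d (Suc n)) (torus_edges d (Suc n))"
    unfolding independent_sets_def by blast
  moreover have "finite (independent_sets (torus_box d (Suc n)) (torus_edges d (Suc n)))"
    by (intro finite_independent_sets finite_torus_box)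
  ultimately show ?thesis
    unfolding num_indep_def num_indep_box_def carrier_torus_group[OF zero_less_Suc]
    by (intro card_mono)
qed

section \<open>Subadditivity over boxes and Fekete's lemma\<close>

lemma num_indep_box_pos: "num_indep_box d n \<ge> 1"
proof -
  have "{} \<in> independent_sets (torus_box d n) (box_edges d)"
    by (auto simp: independent_sets_def)
  moreover have "finite (independent_sets (torus_box d n) (box_edges d))"
    by (intro finite_independent_sets finite_torus_box)
  ultimately show ?thesis unfolding num_indep_box_def by (simp add: card_gt_0_iff Suc_le_eq) blast
qed

text \<open>The \<open>q ^ d\<close> translates of the box of side \<open>m\<close> cover the box of
  side \<open>n\<close>. An independent set is determined by its traces on these blocks, and each
  trace, shifted back by \<open>s c\<close>, is independent.\<close>

lemma num_indep_box_tiling: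
  assumes "n \<le> q * m" "m > 0"
  shows "num_indep_box d n \<le> num_indep_box d m ^ (q ^ d)"
proof -
  let ?I = "\<lambda>n. independent_sets (torus_box d n) (box_edges d)"
  let ?C = "torus_box d q"
  define s where "s c y = (\<lambda>j\<in>{..<d}. c j * int m + y j)" for c y :: "nat \<Rightarrow> int"
  define T where "T I = (\<lambda>c\<in>?C. {y \<in> torus_box d m. s c y \<in> I})" for I
  have "inj_on T (?I n)"
  proof (rule inj_onI)
    have sub: "I \<subseteq> J" if I: "I \<in> ?I n" and eq: "T I = T J" for I J
    proof
      fix x assume x: "x \<in> I"
      then have xn: "x \<in> torus_box d n" using I by (auto simp: independent_sets_def)
      define c where "c = (\<lambda>j\<in>{..<d}. x j div int m)"
      define y where "y = (\<lambda>j\<in>{..<d}. x j mod int m)"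
      have "x j div int m < int q" if "j < d" for j
      proof -
        have "x j div int m * int m \<le> x j"
          using assms(2) by (simp flip: minus_mod_eq_div_mult)
        also have "\<dots> < int n" using xn that by (auto simp: PiE_iff)
        also have "\<dots> \<le> int q * int m" using assms(1) by (metis of_nat_le_iff of_nat_mult)
        finally show ?thesis using assms(2) by (simp add: mult_less_cancel_right)
      qed
      then have c: "c \<in> ?C" using xn assms(2)
        by (auto simp: c_def PiE_iff pos_imp_zdiv_nonneg_iff)
      have y: "y \<in> torus_box d m" using assms(2) by (auto simp: y_def)
      have sx: "s c y = x"
        using xn by (auto simp: s_def c_def y_def fun_eq_iff PiE_iff extensional_def)
      have "y \<in> T I c" using c y x sx by (simp add: T_def)
      then have "y \<in> T J c" using eq by simp
      then show "x \<in> J" using c sx by (simp add: T_def)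
    qed
    fix I J assume "I \<in> ?I n" "J \<in> ?I n" "T I = T J"
    then show "I = J" using sub[of I J] sub[of J I] by simp
  qed
  moreover have "T ` ?I n \<subseteq> ?C \<rightarrow>\<^sub>E ?I m"
  proof (rule image_subsetI)
    fix I assume I: "I \<in> ?I n"
    have "{y, z} \<notin> box_edges d" if "s c y \<in> I" "s c z \<in> I" for c y z
    proof
      assume "{y, z} \<in> box_edges d"
      then obtain w i where w: "i < d" "{y, z} = {w, w(i := w i + 1)}" by (auto simp: box_edges_def)
      have "s c (w(i := w i + 1)) = (s c w)(i := s c w i + 1)"
        using w(1) by (auto simp: s_def fun_eq_iff)
      then have "{s c y, s c z} = {s c w, (s c w)(i := s c w i + 1)}"
        using w(2) by (auto simp: doubleton_eq_iff)
      then have "{s c y, s c z} \<in> box_edges d" using w(1) by (auto simp: box_edges_def)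
      then show False using I that by (auto simp: independent_sets_def)
    qed
    then show "T I \<in> ?C \<rightarrow>\<^sub>E ?I m" by (auto simp: T_def independent_sets_def)
  qed
  moreover have fin: "finite (?I m)"
    by (intro finite_independent_sets finite_torus_box)
  ultimately have "card (?I n) \<le> card (?C \<rightarrow>\<^sub>E ?I m)"
    by (intro card_inj_on_le[of T] finite_PiE) (auto simp: finite_torus_box)
  also have "\<dots> = card (?I m) ^ (q ^ d)"
    using finite_torus_box[of d q] by (subst card_PiE) (simp_all add: card_torus_box)
  finally show ?thesis by (simp add: num_indep_box_def)
qed

text \<open>Fekete's lemma in dimension \<open>d\<close>. The infimum is a lower bound at once; for
  the upper bound a single \<open>m\<close> with nearly minimal quotient is used to cover all large
  \<open>n\<close>.\<close>

lemma fekete_box: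
  fixes f :: "nat \<Rightarrow> real"
  assumes nonneg: "\<And>n. f n \<ge> 0"
    and sub: "\<And>n q m. n \<le> q * m \<Longrightarrow> m > 0 \<Longrightarrow> f n \<le> real (q ^ d) * f m"
  shows "(\<lambda>n. f n / real (n ^ d)) \<longlonglongrightarrow> (INF m\<in>{1..}. f m / real (m ^ d))"
proof (rule order_tendstoI)
  let ?g = "\<lambda>m. f m / real (m ^ d)"
  have bdd: "bdd_below (?g ` {1..})" using nonneg by (intro bdd_belowI2[of _ 0]) simp
  {
    fix a assume a: "a < (INF m\<in>{1..}. ?g m)"
    have "a < ?g n" if "n \<ge> 1" for n
      using cINF_lower[OF bdd, of n] a that by simp
    then show "\<forall>\<^sub>F n in sequentially. a < ?g n" by (rule eventually_sequentiallyI)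
  }
  fix a assume "(INF m\<in>{1..}. ?g m) < a"
  then obtain m where m: "m \<ge> 1" "?g m < a" using cINF_less_iff[OF _ bdd] by auto
  have "(\<lambda>n. (1 / real m + 1 / real n) ^ d * f m) \<longlonglongrightarrow> (1 / real m + 0) ^ d * f m"
    by (intro tendsto_intros lim_1_over_n)
  moreover have "(1 / real m + 0) ^ d * f m < a" using m(2) by (simp add: power_divide)
  ultimately have "\<forall>\<^sub>F n in sequentially. (1 / real m + 1 / real n) ^ d * f m < a"
    by (rule order_tendstoD(2))
  then show "\<forall>\<^sub>F n in sequentially. ?g n < a"
    using eventually_ge_at_top[of 1]
  proof eventually_elim
    case (elim n)
    \<comment> \<open>Rounding up the number of blocks costs at most one per direction, which is the
      \<open>1 / real n\<close> that vanishes in the limit.\<close>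
    define q where "q = n div m + 1"
    have "n < q * m" using m(1) unfolding q_def
      by (metis Suc_eq_plus1 dividend_less_div_times less_le_trans mult.commute mult_Suc zero_less_one add.commute)
    then have "f n \<le> real (q ^ d) * f m" using m(1) by (intro sub) auto
    also have "\<dots> \<le> (real n / real m + 1) ^ d * f m"
    proof (intro mult_right_mono nonneg)
      have "real q \<le> real n / real m + 1" by (simp add: q_def of_nat_div_le_of_nat)
      then show "real (q ^ d) \<le> (real n / real m + 1) ^ d" by (simp add: power_mono)
    qed
    finally have "?g n \<le> (real n / real m + 1) ^ d * f m / real (n ^ d)"
      by (rule divide_right_mono) simp
    also have "\<dots> = ((real n / real m + 1) / real n) ^ d * f m" by (simp add: power_divide)
    also have "(real n / real m + 1) / real n = 1 / real m + 1 / real n"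
      using elim(2) m(1) by (simp add: field_simps)
    also note elim(1)
    finally show ?case .
  qed
qed

text \<open>\<open>kappa\<close> is defined through \<open>lim\<close>, which is informative only
  once convergence is known. Taking logarithms turns the tiling bound into the hypothesis of
  \<open>fekete_box\<close>.\<close>

lemma kappa_tendsto:
  assumes "d \<ge> 1"
  shows "(\<lambda>n. real (num_indep d n) powr (1 / real (n ^ d))) \<longlonglongrightarrow> kappa d"
proof -
  define f where "f n = ln (real (num_indep_box d n))" for n
  define L where "L = (INF m\<in>{1..}. f m / real (m ^ d))"
  have pos: "real (num_indep_box d n) \<ge> 1" for n using num_indep_box_pos[of d n] by simp
  have f: "(\<lambda>n. f n / real (n ^ d)) \<longlonglongrightarrow> L"
    unfolding L_def
  proof (rule fekete_box)
    show "f n \<ge> 0" for n using pos by (simp add: f_def)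
    show "f n \<le> real (q ^ d) * f m" if "n \<le> q * m" "m > 0" for n q m
    proof -
      have "real (num_indep_box d n) \<le> real (num_indep_box d m) ^ (q ^ d)"
        using num_indep_box_tiling[OF that, of d] by (simp flip: of_nat_power)
      then have "ln (real (num_indep_box d n)) \<le> ln (real (num_indep_box d m) ^ (q ^ d))"
        using pos[of n] by (intro ln_mono) auto
      then show ?thesis using pos[of m] by (simp add: f_def ln_realpow)
    qed
  qed
  \<comment> \<open>The index is shifted because the box of side \<open>n\<close> sits in the torus
    of side \<open>Suc n\<close>; this also avoids side 0.\<close>
  define h where "h n = ln (real (num_indep d (Suc n))) / real (Suc n ^ d)" for n
  have ge1: "real (num_indep d (Suc n)) \<ge> 1" for n
    using num_indep_box_le[of d n] num_indep_box_pos[of d n] by simp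
  have "h \<longlonglongrightarrow> L"
  proof (rule tendsto_sandwich)
    \<comment> \<open>The second factor, which tends to 1, exchanges the volume of the box for that
      of the larger torus.\<close>
    show "\<forall>\<^sub>F n in sequentially. (f n / real (n ^ d)) * (real n / real (Suc n)) ^ d \<le> h n"
      using eventually_gt_at_top[of 0]
    proof eventually_elim
      case (elim n)
      have "(f n / real (n ^ d)) * (real n / real (Suc n)) ^ d = f n / real (Suc n ^ d)"
        using elim by (simp add: power_divide)
      also have "\<dots> \<le> h n"
        unfolding h_def f_def using num_indep_box_le[of d n] pos[of n]
        by (intro divide_right_mono ln_mono) auto
      finally show ?case .
    qed
    show "\<forall>\<^sub>F n in sequentially. h n \<le> f (Suc n) / real (Suc n ^ d)"
    proof (intro always_eventually allI)
      fix n
      show "h n \<le> f (Suc n) / real (Suc n ^ d)"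
        unfolding h_def f_def using num_indep_le_box[of "Suc n" d] ge1[of n]
        by (intro divide_right_mono ln_mono) auto
    qed
    show "(\<lambda>n. f (Suc n) / real (Suc n ^ d)) \<longlonglongrightarrow> L" using f
      by (rule LIMSEQ_Suc)
    have "(\<lambda>n. (f n / real (n ^ d)) * (real n / real (Suc n)) ^ d) \<longlonglongrightarrow> L * 1 ^ d"
      by (intro tendsto_intros f LIMSEQ_n_over_Suc_n)
    then show "(\<lambda>n. (f n / real (n ^ d)) * (real n / real (Suc n)) ^ d) \<longlonglongrightarrow> L" by simp
  qed
  then have "(\<lambda>n. exp (h n)) \<longlonglongrightarrow> exp L" by (rule tendsto_exp)
  moreover have "exp (h n) = real (num_indep d (Suc n)) powr (1 / real (Suc n ^ d))" for n
    using ge1[of n] by (simp add: h_def powr_def)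
  ultimately have "(\<lambda>n. real (num_indep d (Suc n)) powr (1 / real (Suc n ^ d))) \<longlonglongrightarrow> exp L" by simp
  then have "(\<lambda>n. real (num_indep d n) powr (1 / real (n ^ d))) \<longlonglongrightarrow> exp L"
    by (rule LIMSEQ_imp_Suc)
  moreover from this have "kappa d = exp L" unfolding kappa_def by (rule limI)
  ultimately show ?thesis by simp
qed

section \<open>Independent sets of the torus\<close>

lemma pow_torus_group:
  assumes "n > 0" "x \<in> torus_box d n"
  shows "x [^]\<^bsub>torus_group d n\<^esub> m = (\<lambda>j\<in>{..<d}. (int m * x j) mod int n)"
proof (induction m)
  case 0
  show ?case by (simp add: one_torus_group)
next
  case (Suc m)
  interpret comm_group "torus_group d n" by (rule comm_group_torus_group)
  show ?case unfolding nat_pow_Suc Suc mult_torus_group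
    by (rule restrict_ext) (simp add: mod_simps algebra_simps)
qed

lemma torus_gens_subset: "n > 0 \<Longrightarrow> torus_gens d n \<subseteq> torus_box d n"
  using torus_basis_in_carrier[of n d] by (auto simp: torus_gens_def inv_torus_basis)

lemma num_indep_cong_1:
  assumes "d \<ge> 1" "k \<ge> 1" "prime p"
  shows "[num_indep d (p ^ k) = 1] (mod p)"
proof -
  let ?n = "p ^ k" and ?s = "torus_basis d (p ^ k) 0"
  have p: "p \<ge> 2" using assms(3) by (rule prime_ge_2_nat)
  \<comment> \<open>On the torus of side 1 the basis vector is the identity and not a generator, so
    \<open>k\<close> has to be positive.\<close>
  then have n: "?n \<ge> 2" using assms(2) self_le_power[of p k] by simp
  interpret comm_group "torus_group d ?n" by (rule comm_group_torus_group)
  have "?s [^]\<^bsub>torus_group d ?n\<^esub> ?n = \<one>\<^bsub>torus_group d ?n\<^esub>"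
    using n p by (subst pow_torus_group[OF _ torus_basis_in_carrier]) (simp_all add: one_torus_group)
  moreover have "carrier (torus_group d ?n) = torus_box d ?n" using n
    by (intro carrier_torus_group) linarith
  moreover have "torus_gens d ?n \<subseteq> torus_box d ?n" using n
    by (intro torus_gens_subset) linarith
  moreover have "?s \<in> torus_gens d ?n" using n assms(1) by (intro torus_basis_in_gens) auto
  ultimately show ?thesis
    unfolding num_indep_def torus_edges_def
    using assms(3) by (intro card_independent_sets_cayley_cong_1[of _ ?s p k]) (simp_all add: finite_PiE)
qed

text \<open>A basis vector and its inverse have i-th coordinates 1 and n - 1, which differ for
  \<open>n\<close> of at least 3; for \<open>n = 2\<close> they coincide and the degree drops to
  \<open>d\<close>.\<close>

lemma card_torus_gens:
  assumes "n \<ge> 3"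
  shows "card (torus_gens d n) = 2 * d"
proof -
  let ?b = "torus_basis d n" and ?c = "\<lambda>i. inv\<^bsub>torus_group d n\<^esub> torus_basis d n i"
  have n: "n > 0" using assms by simp
  have b: "?b i j = (if j = i then 1 else 0)" if "j < d" for i j
    using that assms by (simp add: torus_basis_def)
  have c: "?c i j = (if j = i then int n - 1 else 0)" if "j < d" for i j
    using that assms by (simp add: inv_torus_basis[OF n] zmod_minus1)
  have "?b i \<noteq> \<one>\<^bsub>torus_group d n\<^esub>" "?c i \<noteq> \<one>\<^bsub>torus_group d n\<^esub>" if "i < d" for i
    using b[OF that, of i] c[OF that, of i] that assms by (auto simp: one_torus_group)
  then have "torus_gens d n = ?b ` {..<d} \<union> ?c ` {..<d}"
    unfolding torus_gens_def
    by (intro Diff_triv) (auto simp: eq_commute[of "\<one>\<^bsub>torus_group d n\<^esub>"])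
  moreover have "inj_on ?b {..<d}"
  proof (rule inj_onI)
    fix i j assume ij: "i \<in> {..<d}" "j \<in> {..<d}" "?b i = ?b j"
    then have "?b i i = ?b j i" by simp
    then show "i = j" using ij(1,2) by (simp add: b split: if_splits)
  qed
  moreover have "inj_on ?c {..<d}"
  proof (rule inj_onI)
    fix i j assume ij: "i \<in> {..<d}" "j \<in> {..<d}" "?c i = ?c j"
    then have "?c i i = ?c j i" by simp
    then show "i = j" using ij(1,2) assms by (simp add: c split: if_splits)
  qed
  moreover have "?b ` {..<d} \<inter> ?c ` {..<d} = {}"
  proof -
    have "?b i \<noteq> ?c j" if "i < d" "j < d" for i j
    proof
      assume "?b i = ?c j"
      then have "?b i i = ?c j i" by simp
      then show False using that assms by (simp add: b c split: if_splits)
    qed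
    then show ?thesis by blast
  qed
  ultimately show ?thesis by (simp add: card_Un_disjoint card_image)
qed

lemma even_sum_upd:
  fixes x :: "nat \<Rightarrow> int"
  assumes "i < d" "odd (y - x i)"
  shows "even (\<Sum>j<d. (x(i := y)) j) \<longleftrightarrow> odd (\<Sum>j<d. x j)"
proof -
  have "(\<Sum>j<d. (x(i := y)) j) = y + (\<Sum>j\<in>{..<d} - {i}. (x(i := y)) j)"
    using assms(1) by (subst sum.remove[of _ i]) auto
  also have "(\<Sum>j\<in>{..<d} - {i}. (x(i := y)) j) = (\<Sum>j\<in>{..<d} - {i}. x j)"
    by (intro sum.cong) auto
  also have "y + \<dots> = (y - x i) + (\<Sum>j<d. x j)"
    using assms(1) by (subst (2) sum.remove[of _ i]) auto
  finally show ?thesis using assms(2) by simp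
qed

text \<open>The colouring is the parity of the coordinate sum. The 4 in the exponent is 2 for one
  colour class being half of the vertices, times 2 from the degree 2d.\<close>

lemma num_indep_even_le:
  assumes "d \<ge> 1" "even n" "n \<ge> 3"
  shows "real (num_indep d n) \<le> (2 ^ (2 * d + 1) - 1) powr (real (n ^ d) / (4 * real d))"
proof -
  interpret comm_group "torus_group d n" by (rule comm_group_torus_group)
  have n: "n > 0" using assms by simp
  have "real (card (independent_sets (carrier (torus_group d n)) (cayley_edges (torus_group d n) (torus_gens d n))))
    \<le> (2 ^ (card (torus_gens d n) + 1) - 1) powr
       (real (card (carrier (torus_group d n))) / (2 * real (card (torus_gens d n))))"
  proof (rule card_independent_sets_cayley_bipartite)
    show "finite (carrier (torus_group d n))" by (simp add: carrier_torus_group n finite_torus_box)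
    show sub: "torus_gens d n \<subseteq> carrier (torus_group d n)"
      by (simp add: carrier_torus_group n torus_gens_subset)
    show "torus_gens d n \<noteq> {}" using card_torus_gens[OF assms(3), of d] assms(1) by auto
    show "inv\<^bsub>torus_group d n\<^esub> s \<in> torus_gens d n"
      if s: "s \<in> torus_gens d n" for s
    proof -
      have "inv\<^bsub>torus_group d n\<^esub> s \<noteq> \<one>\<^bsub>torus_group d n\<^esub>"
        using s sub by (auto simp: torus_gens_def inv_eq_1_iff)
      moreover have "inv\<^bsub>torus_group d n\<^esub> (inv\<^bsub>torus_group d n\<^esub> torus_basis d n i) = torus_basis d n i" for i
        using torus_basis_in_carrier[OF n] by (simp add: carrier_torus_group n)
      ultimately show ?thesis using s by (auto simp: torus_gens_def)
    qed
    fix x s assume x: "x \<in> carrier (torus_group d n)" and s: "s \<in> torus_gens d n"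
    then have xV: "x \<in> torus_box d n" by (simp add: carrier_torus_group n)
    obtain i where i: "i < d" "s = torus_basis d n i \<or> s = inv\<^bsub>torus_group d n\<^esub> torus_basis d n i"
      using s by (auto simp: torus_gens_def)
    \<comment> \<open>Reduction modulo an even \<open>n\<close> preserves parity, so wrapping around
      also changes the colour.\<close>
    have par: "odd (a mod int n - x i)" if "odd (a - x i)" for a
      using that assms(2) by (simp add: dvd_mod_iff)
    from i(2) show "even (\<Sum>j<d. (x \<otimes>\<^bsub>torus_group d n\<^esub> s) j) \<longleftrightarrow> \<not> even (\<Sum>j<d. x j)"
    proof
      assume "s = torus_basis d n i"
      then have "x \<otimes>\<^bsub>torus_group d n\<^esub> s = x(i := (x i + 1) mod int n)"
        using mult_torus_basis[OF xV i(1)] by simp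
      then show ?thesis using even_sum_upd[of i d "(x i + 1) mod int n" x] i(1) par[of "x i + 1"]
        by simp
    next
      assume "s = inv\<^bsub>torus_group d n\<^esub> torus_basis d n i"
      then have "x \<otimes>\<^bsub>torus_group d n\<^esub> s = x(i := (x i - 1) mod int n)"
        using mult_inv_torus_basis[OF xV i(1)] by simp
      then show ?thesis using even_sum_upd[of i d "(x i - 1) mod int n" x] i(1) par[of "x i - 1"]
        by simp
    qed
  qed
  then show ?thesis
    by (simp add: num_indep_def torus_edges_def card_torus_gens[OF assms(3)] carrier_torus_group n card_torus_box)
qed

section \<open>Bounds for the limit\<close>

lemma kappa_le:
  assumes "d \<ge> 1"
  shows "kappa d \<le> (2 ^ (2 * d + 1) - 1) powr (1 / (4 * real d))"
proof (rule LIMSEQ_le_const2)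
  \<comment> \<open>The even sides from 4 on, where the torus is bipartite and regular of degree
    2d.\<close>
  define r :: "nat \<Rightarrow> nat" where "r n = 2 * (n + 2)" for n
  have "strict_mono r" by (simp add: r_def strict_mono_def)
  then show "(\<lambda>n. real (num_indep d (r n)) powr (1 / real (r n ^ d))) \<longlonglongrightarrow> kappa d"
    using LIMSEQ_subseq_LIMSEQ[OF kappa_tendsto[OF assms]] by (simp add: o_def)
  have "real (num_indep d (r n)) powr (1 / real (r n ^ d)) \<le> (2 ^ (2 * d + 1) - 1) powr (1 / (4 * real d))" for n
  proof -
    have "real (num_indep d (r n)) powr (1 / real (r n ^ d))
        \<le> ((2 ^ (2 * d + 1) - 1) powr (real (r n ^ d) / (4 * real d))) powr (1 / real (r n ^ d))"
      using num_indep_even_le[OF assms, of "r n"] by (intro powr_mono2) (auto simp: r_def)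
    also have "\<dots> = (2 ^ (2 * d + 1) - 1) powr (1 / (4 * real d))"
      unfolding powr_powr by (rule arg_cong[of _ _ "\<lambda>e. _ powr e"]) (simp add: r_def)
    finally show ?thesis .
  qed
  then show "\<exists>N. \<forall>n\<ge>N. real (num_indep d (r n)) powr (1 / real (r n ^ d)) \<le> (2 ^ (2 * d + 1) - 1) powr (1 / (4 * real d))"
    by blast
qed

lemma kappa_ge_1:
  assumes "d \<ge> 1"
  shows "kappa d \<ge> 1"
proof (rule LIMSEQ_le_const[OF kappa_tendsto[OF assms]])
  have "1 \<le> real (num_indep d n) powr (1 / real (n ^ d))" if "n \<ge> 1" for n
    using num_indep_box_le[of d "n - 1"] num_indep_box_pos[of d "n - 1"] that
    by (intro ge_one_powr_ge_zero) auto
  then show "\<exists>N. \<forall>n\<ge>N. 1 \<le> real (num_indep d n) powr (1 / real (n ^ d))"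
    by blast
qed

text \<open>Besides the empty set there is a singleton, independent because the identity is no
  generator and so there are no loops. This rules out \<open>kappa d = 1\<close> at an exact
  size.\<close>

lemma num_indep_ge_2:
  assumes "n \<ge> 1"
  shows "num_indep d n \<ge> 2"
proof -
  let ?G = "torus_group d n"
  interpret comm_group ?G by (rule comm_group_torus_group)
  have n: "n > 0" using assms by simp
  have edge: "{\<one>\<^bsub>?G\<^esub>, \<one>\<^bsub>?G\<^esub>} \<notin> torus_edges d n"
  proof
    assume "{\<one>\<^bsub>?G\<^esub>, \<one>\<^bsub>?G\<^esub>} \<in> torus_edges d n"
    then obtain x s where xs: "s \<in> torus_gens d n" "{\<one>\<^bsub>?G\<^esub>, \<one>\<^bsub>?G\<^esub>} = {x, x \<otimes>\<^bsub>?G\<^esub> s}"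
      by (auto simp: torus_edges_def cayley_edges_def)
    have s: "s \<in> carrier ?G" using xs(1) torus_gens_subset[OF n]
      by (auto simp: carrier_torus_group n)
    have "x = \<one>\<^bsub>?G\<^esub>" "x \<otimes>\<^bsub>?G\<^esub> s = \<one>\<^bsub>?G\<^esub>"
      using xs(2) by (auto simp: doubleton_eq_iff)
    then have "s = \<one>\<^bsub>?G\<^esub>" using s by (simp only: l_one)
    then show False using xs(1) by (simp add: torus_gens_def)
  qed
  have "{{}, {\<one>\<^bsub>?G\<^esub>}} \<subseteq> independent_sets (carrier ?G) (torus_edges d n)"
    using edge one_closed by (simp add: independent_sets_def)
  moreover have "finite (independent_sets (carrier ?G) (torus_edges d n))"
    by (intro finite_independent_sets) (simp add: carrier_torus_group n finite_torus_box)
  ultimately have "card {{}, {\<one>\<^bsub>?G\<^esub>}} \<le> num_indep d n"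
    unfolding num_indep_def by (intro card_mono)
  then show ?thesis by simp
qed

theorem corollary5p14:
  fixes d p k :: nat and R :: real
  assumes "d \<ge> 1"
    and "algebraic (kappa d)"
    and "prime p" and "k \<ge> 1" and "p ^ k \<in> exact_sizes d"
    and "\<And>\<alpha>. \<alpha> \<in> rat_conjugates (kappa d) \<Longrightarrow> \<alpha> \<noteq> complex_of_real (kappa d) \<Longrightarrow> cmod \<alpha> < R"
  shows "real p \<le> ((2 ^ (2 * d + 1) - 1) powr (1 / (4 * real d)) - 1)
                   * (R + 1) ^ (rat_ext_degree (kappa d) - 1)"
proof -
  let ?m = "rat_min_poly (kappa d)"
  \<comment> \<open>The number of vertices is itself a power of \<open>p\<close>, as the
    divisibility argument requires.\<close>
  have pk: "p ^ k \<ge> 1" "real (num_indep d (p ^ k)) = kappa d ^ (p ^ (k * d))"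
    using assms(5) by (auto simp: exact_sizes_def power_mult)
  have k1: "kappa d \<noteq> 1" using pk num_indep_ge_2[OF pk(1), of d] by auto
  have "rat_of_nat p \<le> \<bar>poly ?m 1\<bar>"
    using assms(2,3) pk(2)[symmetric] num_indep_cong_1[OF assms(1,4,3)] k1
    by (rule prime_le_abs_min_poly_1)
  then have "real_of_rat (rat_of_nat p) \<le> real_of_rat \<bar>poly ?m 1\<bar>"
    by (simp only: of_rat_less_eq)
  also have "\<dots> \<le> \<bar>kappa d - 1\<bar> * (R + 1) ^ (degree ?m - 1)"
    using assms(2,6) by (rule abs_min_poly_1_le)
  finally have le: "real p \<le> \<bar>kappa d - 1\<bar> * (R + 1) ^ (degree ?m - 1)" by simp
  also have "\<dots> \<le> ((2 ^ (2 * d + 1) - 1) powr (1 / (4 * real d)) - 1) * (R + 1) ^ (degree ?m - 1)"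
  proof (rule mult_right_mono)
    show "\<bar>kappa d - 1\<bar> \<le> (2 ^ (2 * d + 1) - 1) powr (1 / (4 * real d)) - 1"
      using kappa_le[OF assms(1)] kappa_ge_1[OF assms(1)] by simp
    \<comment> \<open>The sign of \<open>R + 1\<close> is not given, since there may be no other
      conjugate to bound; the power is nonnegative because its product with a nonnegative number is
      at least \<open>p\<close>.\<close>
    have "0 < real p" using assms(3) by (simp add: prime_gt_0_nat)
    also note le
    finally show "0 \<le> (R + 1) ^ (degree ?m - 1)" by (simp add: zero_less_mult_iff)
  qed
  finally show ?thesis by (simp add: rat_ext_degree_eq[OF assms(2)])
qed

end
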